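(* Let $(y_0^0,0)$ be the initial datum and $(y_1^0,0)$ be the final target, with $y_0^0\in\mathbb{R}^+$ and $y_1^0\in\mathbb{R}^+$ (constant functions on $(0,1)$, zero velocities), for the one-dimensional wave equation controlled from the boundary $$\begin{cases} y_{tt}-y_{xx}=0 & (t,x)\in(0,T)\times(0,1)\\ y(t,0)=u_0(t),\ y(t,1)=u_1(t) & t\in(0,T)\\ y(0,x)=y_0^0,\ y_t(0,x)=0 & x\in(0,1).\end{cases}$$ Then: (1) For any time $T>1$, there exist two nonnegative controls $$u_0(t)=\begin{cases} y_0^0 & t\in[0,1)\\ (y_1^0-y_0^0)\frac{t-1}{T-1}+y_0^0 & t\in(1,T]\end{cases}\qquad u_1(t)=\begin{cases}(y_1^0-y_0^0)\frac{t}{T-1}+y_0^0 & t\in[0,T-1)\\ y_1^0 & t\in[T-1,T]\end{cases}$$ driving the equation from $(y_0^0,0)$ to $(y_1^0,0)$ in time $T$. Moreover, the corresponding solution remains nonnegative, i.e. $y(t,x)\ge0$ for all $(t,x)\in[0,T]\times[0,1]$. (2) $T_{\min}^s=T_{\min}^c=T_{\min}=1$. (3) The nonnegative controls $\hat{u}_0\equiv y_0^0$ and $\hat{u}_1\equiv y_1^0$ in $L^2(0,1)$ steer the equation from $(y_0^0,0)$ to $(y_1^0,0)$ in the minimal time. Furthermore, the corresponding solution satisfies $y\ge0$ a.e. in $(0,1)\times(0,1)$. (4) The controls in the minimal time are not unique. In particular, for any $\lambda\in[0,1]$, $\hat{u}^0_\lambda=(1-\lambda)y_0^0+\lambda y_1^0$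 (at $x=0$) and $\hat{u}^1_\lambda=(1-\lambda)y_1^0+\lambda y_0^0$ (at $x=1$) drive the equation from $(y_0^0,0)$ to $(y_1^0,0)$ in the minimal time.
   Context: $\mathbb{R}^+=[0,+\infty)$. For every initial datum in $L^2(0,1)\times H^{-1}(0,1)$ and controls $u_0,u_1\in L^2(0,T)$ the equation has a unique solution $(y,y_t)\in C^0([0,T];L^2(0,1)\times H^{-1}(0,1))$, defined by transposition. Controls drive (steer) the equation from $(y_0^0,0)$ to $(y_1^0,0)$ in time $T$ if this solution satisfies $(y(T,\cdot),y_t(T,\cdot))=(y_1^0,0)$. Minimal times, for the given initial datum and target: $L^2(0,T)^+$ denotes the nonnegative functions in $L^2(0,T)$, and $T_{\min}=\inf\{T>0:\ \exists u_0,u_1\in L^2(0,T),\ (y(T,\cdot),y_t(T,\cdot))=(y_1^0,0)\}$ (no constraints); $T_{\min}^c=\inf\{T>0:\ \exists u_0,u_1\in L^2(0,T)^+,\ (y(T,\cdot),y_t(T,\cdot))=(y_1^0,0)\}$ (control constraints); $T_{\min}^s=\inf\{T>0:\ \exists u_0,u_1\in L^2(0,T)^+,\ (y(T,\cdot),y_t(T,\cdot))=(y_1^0,0),\ y\ge0\}$ (control and state constraints).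
   Formalization: Part (2) and the non-uniqueness sentence of (4) are stated for y_0^0 ≠ y_1^0 (if they are equal, constant controls work in every T>0 and all minimal times are 0); in (3) and (4) "the minimal time" is read as time 1. *)

theory Defs
  imports "HOL-Analysis.Analysis"
begin

text \<open>Elements of \<open>L\<^sup>2(a,b)\<close> are represented by functions that are measurable and
  square integrable on the closed interval, whose endpoints form a null set; equality in
  \<open>L\<^sup>2\<close> is equality almost everywhere.\<close>

definition L2 :: "real \<Rightarrow> real \<Rightarrow> (real \<Rightarrow> real) set" where
  "L2 a b = {f \<in> borel_measurable (lebesgue_on {a..b}).
               integrable (lebesgue_on {a..b}) (\<lambda>x. (f x)\<^sup>2)}"

definition L2_norm :: "real \<Rightarrow> real \<Rightarrow> (real \<Rightarrow> real) \<Rightarrow> real" where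
  "L2_norm a b f = sqrt (LINT x|lebesgue_on {a..b}. (f x)\<^sup>2)"

definition L2_nonneg :: "real \<Rightarrow> real \<Rightarrow> (real \<Rightarrow> real) set" where
  "L2_nonneg a b = {f \<in> L2 a b. AE x in lebesgue_on {a..b}. 0 \<le> f x}"

text \<open>\<open>H\<^sup>1\<^sub>0(0,1)\<close>: in dimension one its elements are, through their continuous representatives,
  the primitives of \<open>L\<^sup>2\<close> functions that vanish at both endpoints. \<open>H10_deriv \<phi> g\<close> says that
  \<open>\<phi>\<close> is such a function with weak derivative \<open>g\<close>; its norm is the \<open>L\<^sup>2\<close> norm of \<open>g\<close>.\<close>

definition H10_deriv :: "(real \<Rightarrow> real) \<Rightarrow> (real \<Rightarrow> real) \<Rightarrow> bool" where
  "H10_deriv \<phi> g \<longleftrightarrow> g \<in> L2 0 1 \<and>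
     (\<forall>x\<in>{0..1}. \<phi> x = (LINT s|lebesgue_on {0..x}. g s)) \<and> \<phi> 1 = 0"

definition H10 :: "(real \<Rightarrow> real) set" where
  "H10 = {\<phi>. \<exists>g. H10_deriv \<phi> g}"

text \<open>\<open>H\<^sup>-\<^sup>1(0,1)\<close> is the dual of \<open>H\<^sup>1\<^sub>0(0,1)\<close>. \<open>Hm1_bound l C\<close> says that the dual norm of \<open>l\<close> is
  at most \<open>C\<close>. For a linear \<open>l\<close> it also forces \<open>l \<phi>\<close> to depend only on the values of \<open>\<phi>\<close>
  on \<open>[0,1]\<close>.\<close>

definition Hm1_bound :: "((real \<Rightarrow> real) \<Rightarrow> real) \<Rightarrow> real \<Rightarrow> bool" where
  "Hm1_bound l C \<longleftrightarrow> (\<forall>\<phi> g. H10_deriv \<phi> g \<longrightarrow> \<bar>l \<phi>\<bar> \<le> C * L2_norm 0 1 g)"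

definition Hm1 :: "((real \<Rightarrow> real) \<Rightarrow> real) set" where
  "Hm1 = {l. (\<forall>\<phi>\<in>H10. \<forall>\<psi>\<in>H10. \<forall>a b. l (\<lambda>x. a * \<phi> x + b * \<psi> x) = a * l \<phi> + b * l \<psi>) \<and>
             (\<exists>C. Hm1_bound l C)}"

definition L2_continuous :: "real \<Rightarrow> (real \<Rightarrow> real \<Rightarrow> real) \<Rightarrow> bool" where
  "L2_continuous T y \<longleftrightarrow> (\<forall>t\<in>{0..T}. y t \<in> L2 0 1 \<and>
     ((\<lambda>s. L2_norm 0 1 (\<lambda>x. y s x - y t x)) \<longlongrightarrow> 0) (at t within {0..T}))"

definition Hm1_continuous :: "real \<Rightarrow> (real \<Rightarrow> (real \<Rightarrow> real) \<Rightarrow> real) \<Rightarrow> bool" where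
  "Hm1_continuous T z \<longleftrightarrow> (\<forall>t\<in>{0..T}. z t \<in> Hm1 \<and>
     (\<forall>\<epsilon>>0. eventually (\<lambda>s. Hm1_bound (\<lambda>\<phi>. z s \<phi> - z t \<phi>) \<epsilon>) (at t within {0..T})))"

text \<open>The functions that test transposition: solutions of class \<open>C\<^sup>2\<close> on \<open>[0,T] \<times> [0,1]\<close> of the
  adjoint problem, i.e. the wave equation with homogeneous Dirichlet conditions. Their Cauchy
  data (at any time) are dense in \<open>H\<^sup>1\<^sub>0 \<times> L\<^sup>2\<close>, since they contain all
  \<open>sin (k \<pi> x) * cos (k \<pi> t)\<close> and \<open>sin (k \<pi> x) * sin (k \<pi> t)\<close>.\<close>

definition adjoint_solution ::
  "real \<Rightarrow> (real \<Rightarrow> real \<Rightarrow> real) \<Rightarrow> (real \<Rightarrow> real \<Rightarrow> real) \<Rightarrow> (real \<Rightarrow> real \<Rightarrow> real) \<Rightarrow> bool" where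
  "adjoint_solution T \<phi> \<phi>t \<phi>x \<longleftrightarrow>
    (\<exists>\<phi>tt \<phi>tx \<phi>xx.
       (\<forall>t\<in>{0..T}. \<forall>x\<in>{0..1}.
          ((\<lambda>s. \<phi> s x) has_real_derivative \<phi>t t x) (at t within {0..T}) \<and>
          ((\<lambda>r. \<phi> t r) has_real_derivative \<phi>x t x) (at x within {0..1}) \<and>
          ((\<lambda>s. \<phi>t s x) has_real_derivative \<phi>tt t x) (at t within {0..T}) \<and>
          ((\<lambda>r. \<phi>t t r) has_real_derivative \<phi>tx t x) (at x within {0..1}) \<and>
          ((\<lambda>s. \<phi>x s x) has_real_derivative \<phi>tx t x) (at t within {0..T}) \<and>
          ((\<lambda>r. \<phi>x t r) has_real_derivative \<phi>xx t x) (at x within {0..1}) \<and>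
          \<phi>tt t x - \<phi>xx t x = 0) \<and>
       (\<forall>\<psi>\<in>{\<phi>tt, \<phi>tx, \<phi>xx}. continuous_on ({0..T} \<times> {0..1}) (\<lambda>p. \<psi> (fst p) (snd p))) \<and>
       (\<forall>t\<in>{0..T}. \<phi> t 0 = 0 \<and> \<phi> t 1 = 0))"

text \<open>\<open>wave_solution T ya va u0 u1 y z\<close>: the pair \<open>(y, z)\<close> with \<open>z = y\<^sub>t\<close> is the solution by
  transposition, continuous on \<open>[0,T]\<close> with values in \<open>L\<^sup>2(0,1) \<times> H\<^sup>-\<^sup>1(0,1)\<close>, of the wave
  equation with boundary controls \<open>u0\<close> (at \<open>x = 0\<close>) and \<open>u1\<close> (at \<open>x = 1\<close>) and initial datum
  \<open>(ya, va)\<close>. The transposition identity is what one obtains by multiplying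
  \<open>y\<^sub>t\<^sub>t - y\<^sub>x\<^sub>x = 0\<close> by \<open>\<phi>\<close> and integrating by parts over \<open>(0,\<tau>) \<times> (0,1)\<close>. By density of the
  test data it determines \<open>y \<tau>\<close> almost everywhere and \<open>z \<tau>\<close> on \<open>H10\<close>, for every \<open>\<tau>\<close>.
  A jointly measurable representative \<open>y\<close> is chosen so that \<open>y \<ge> 0\<close> a.e. makes sense
  on the space-time rectangle.\<close>

definition wave_solution ::
  "real \<Rightarrow> (real \<Rightarrow> real) \<Rightarrow> ((real \<Rightarrow> real) \<Rightarrow> real) \<Rightarrow> (real \<Rightarrow> real) \<Rightarrow> (real \<Rightarrow> real) \<Rightarrow>
   (real \<Rightarrow> real \<Rightarrow> real) \<Rightarrow> (real \<Rightarrow> (real \<Rightarrow> real) \<Rightarrow> real) \<Rightarrow> bool" where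
  "wave_solution T ya va u0 u1 y z \<longleftrightarrow>
     0 < T \<and> ya \<in> L2 0 1 \<and> va \<in> Hm1 \<and> u0 \<in> L2 0 T \<and> u1 \<in> L2 0 T \<and>
     (\<lambda>p. y (fst p) (snd p)) \<in> borel_measurable (lebesgue_on ({0..T} \<times> {0..1})) \<and>
     L2_continuous T y \<and> Hm1_continuous T z \<and>
     (\<forall>\<psi>\<in>H10. \<forall>t\<in>{0..T}.
        ((\<lambda>s. LINT x|lebesgue_on {0..1}. y s x * \<psi> x) has_real_derivative z t \<psi>)
          (at t within {0..T})) \<and>
     (AE x in lebesgue_on {0..1}. y 0 x = ya x) \<and> (\<forall>\<psi>\<in>H10. z 0 \<psi> = va \<psi>) \<and>
     (\<forall>\<phi> \<phi>t \<phi>x. adjoint_solution T \<phi> \<phi>t \<phi>x \<longrightarrow>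
        (\<forall>\<tau>\<in>{0..T}.
           z \<tau> (\<phi> \<tau>) - (LINT x|lebesgue_on {0..1}. y \<tau> x * \<phi>t \<tau> x) =
           va (\<phi> 0) - (LINT x|lebesgue_on {0..1}. ya x * \<phi>t 0 x) +
           (LINT t|lebesgue_on {0..\<tau>}. u0 t * \<phi>x t 0 - u1 t * \<phi>x t 1)))"

text \<open>\<open>drives T ya yb u0 u1 y z\<close>: the controls steer the equation from \<open>(ya, 0)\<close> to \<open>(yb, 0)\<close>
  in time \<open>T\<close>, and \<open>(y, z)\<close> is the corresponding solution. As the solution is unique up to
  the choice of representatives, that \<open>u0\<close>, \<open>u1\<close> drive the equation is the existence of
  \<open>y\<close>, \<open>z\<close> with this property.\<close>

definition drives ::
  "real \<Rightarrow> (real \<Rightarrow> real) \<Rightarrow> (real \<Rightarrow> real) \<Rightarrow> (real \<Rightarrow> real) \<Rightarrow> (real \<Rightarrow> real) \<Rightarrow>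
   (real \<Rightarrow> real \<Rightarrow> real) \<Rightarrow> (real \<Rightarrow> (real \<Rightarrow> real) \<Rightarrow> real) \<Rightarrow> bool" where
  "drives T ya yb u0 u1 y z \<longleftrightarrow>
     wave_solution T ya (\<lambda>_. 0) u0 u1 y z \<and>
     (AE x in lebesgue_on {0..1}. y T x = yb x) \<and> (\<forall>\<psi>\<in>H10. z T \<psi> = 0)"

definition nonneg_state :: "real \<Rightarrow> (real \<Rightarrow> real \<Rightarrow> real) \<Rightarrow> bool" where
  "nonneg_state T y \<longleftrightarrow> (AE p in lebesgue_on ({0..T} \<times> {0..1}). 0 \<le> y (fst p) (snd p))"

text \<open>The infima are taken in the extended reals, so that they equal \<open>\<infinity>\<close> when the target cannot
  be reached.\<close>

definition T_min :: "(real \<Rightarrow> real) \<Rightarrow> (real \<Rightarrow> real) \<Rightarrow> ereal" where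
  "T_min ya yb = Inf (ereal ` {T. 0 < T \<and>
     (\<exists>u0\<in>L2 0 T. \<exists>u1\<in>L2 0 T. \<exists>y z. drives T ya yb u0 u1 y z)})"

definition T_min_c :: "(real \<Rightarrow> real) \<Rightarrow> (real \<Rightarrow> real) \<Rightarrow> ereal" where
  "T_min_c ya yb = Inf (ereal ` {T. 0 < T \<and>
     (\<exists>u0\<in>L2_nonneg 0 T. \<exists>u1\<in>L2_nonneg 0 T. \<exists>y z. drives T ya yb u0 u1 y z)})"

definition T_min_s :: "(real \<Rightarrow> real) \<Rightarrow> (real \<Rightarrow> real) \<Rightarrow> ereal" where
  "T_min_s ya yb = Inf (ereal ` {T. 0 < T \<and>
     (\<exists>u0\<in>L2_nonneg 0 T. \<exists>u1\<in>L2_nonneg 0 T. \<exists>y z.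
        drives T ya yb u0 u1 y z \<and> nonneg_state T y)})"

end

theory Submission
  imports Defs
begin

text \<open>
  The controlled solutions come from d'Alembert's formula \<open>y(t,x) = Q(t + x) + P(t + 1 - x)\<close>,
  with \<open>Q\<close> and \<open>P\<close> bounded and continuous off a countable set. Its boundary values
  \<open>Q(t) + P(t + 1)\<close> and \<open>Q(t + 1) + P(t)\<close> are the controls that produce it, and the state at time
  \<open>t\<close> is at rest with value \<open>a\<close> if \<open>Q(t + x) + P(t + 1 - x) = a\<close> and
  \<open>Q(t + x) - P(t + 1 - x)\<close> is constant for \<open>0 < x < 1\<close>.

  For \<open>T > 1\<close> one takes \<open>P = 0\<close> and for \<open>Q\<close> the ramp that equals \<open>y0\<close> up to 1, equals
  \<open>y1\<close> from \<open>T\<close> on, and is linear in between. For \<open>T = 1\<close> the ramp becomes a step \<open>S\<close> at 1,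
  and \<open>Q = (1 - \<lambda>) S\<close>, \<open>P = \<lambda> S\<close> gives the family of optimal controls; \<open>\<lambda> = 0\<close> and
  \<open>\<lambda> = 1\<close> show that they are not unique. The profiles are nonnegative, hence so are the states
  and controls (\<open>ramp_drives\<close>, \<open>step_drives\<close>).

  That d'Alembert's formula with such rough profiles is a solution by transposition has two parts.
  Its velocity is the \<open>H\<^sup>-\<^sup>1\<close> functional obtained by moving the space derivative to the
  test function (\<open>dalembert_pairing_derivative\<close>), and \<open>L\<^sup>2\<close> continuity of translations makes
  it continuous in time. The transposition identity (\<open>dalembert_balance\<close>) follows from the
  factorisation of the wave operator: for an adjoint solution \<open>\<phi>\<close> the function
  \<open>\<phi>\<^sub>t + \<phi>\<^sub>x\<close> is constant on the characteristics \<open>t + x = const\<close>, as \<open>Q(t + x)\<close> is, so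
  the balance of their product over \<open>(0,\<tau>) \<times> (0,1)\<close> only moves intervals of integration
  (\<open>transport_balance\<close>) and does not differentiate \<open>Q\<close>. The reflection \<open>x \<mapsto> 1 - x\<close> reduces
  \<open>P\<close> to the same case.

  In a time \<open>T < 1\<close> two different rest states cannot be joined: there is an adjoint solution whose
  normal derivative vanishes on both ends, so that the controls do not act on it, but for which
  \<open>\<integral>\<phi>\<^sub>t dx\<close> has the same nonzero value at times 0 and \<open>T\<close>
  (\<open>reaching_different_rest_state_takes_time_1\<close>). Hence all three minimal times are 1.
\<close>

section \<open>Square-integrable functions on an interval\<close>

lemma square_le_of_abs_le: "\<bar>x\<bar> \<le> M \<Longrightarrow> x\<^sup>2 \<le> M\<^sup>2" for x M :: real
  by (metis abs_ge_zero power2_abs power_mono)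

lemma L2_mult_integrable:
  assumes "f \<in> L2 a b" "g \<in> L2 a b"
  shows "integrable (lebesgue_on {a..b}) (\<lambda>x. f x * g x)"
proof (rule Bochner_Integration.integrable_bound)
  show "integrable (lebesgue_on {a..b}) (\<lambda>x. (f x)\<^sup>2 + (g x)\<^sup>2)"
    using assms by (auto simp: L2_def)
  show "(\<lambda>x. f x * g x) \<in> borel_measurable (lebesgue_on {a..b})"
    using assms by (auto simp: L2_def)
  have "\<bar>u\<bar> * \<bar>v\<bar> \<le> u\<^sup>2 + v\<^sup>2" for u v :: real
  proof -
    have "0 \<le> \<bar>u\<bar> * \<bar>v\<bar>" by simp
    moreover have "2 * (\<bar>u\<bar> * \<bar>v\<bar>) \<le> u\<^sup>2 + v\<^sup>2"
      using sum_squares_bound[of "\<bar>u\<bar>" "\<bar>v\<bar>"] by (simp add: mult.assoc)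
    ultimately show ?thesis by linarith
  qed
  then show "AE x in lebesgue_on {a..b}. norm (f x * g x) \<le> norm ((f x)\<^sup>2 + (g x)\<^sup>2)"
    by (simp add: abs_mult)
qed

lemma const_in_L2: "(\<lambda>_. c) \<in> L2 a b"
  by (simp add: L2_def)

lemma L2_integrable:
  assumes "f \<in> L2 a b"
  shows "integrable (lebesgue_on {a..b}) f"
  using L2_mult_integrable[OF assms const_in_L2[of 1]] by simp

lemma bounded_in_L2:
  assumes "f \<in> borel_measurable (lebesgue_on {a..b})" "\<And>x. x \<in> {a..b} \<Longrightarrow> \<bar>f x\<bar> \<le> M"
  shows "f \<in> L2 a b"
  unfolding L2_def
proof (intro CollectI conjI assms(1))
  show "integrable (lebesgue_on {a..b}) (\<lambda>x. (f x)\<^sup>2)"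
  proof (rule Bochner_Integration.integrable_bound[of _ "\<lambda>_. M\<^sup>2"])
    show "AE x in lebesgue_on {a..b}. norm ((f x)\<^sup>2) \<le> norm (M\<^sup>2)"
      using assms(2) by (intro AE_I2) (simp add: square_le_of_abs_le)
  qed (use assms in auto)
qed

lemma continuous_in_L2:
  fixes f :: "real \<Rightarrow> real"
  assumes "continuous_on {a..b} f"
  shows "f \<in> L2 a b"
proof -
  obtain M where "\<And>x. x \<in> {a..b} \<Longrightarrow> norm (f x) \<le> M"
    by (metis assms compact_Icc compact_continuous_image compact_imp_bounded bounded_iff imageI)
  then show ?thesis
    using assms by (intro bounded_in_L2 continuous_imp_measurable_on_sets_lebesgue) auto
qed

lemma L2_lin:
  assumes "f \<in> L2 a b" "g \<in> L2 a b"
  shows "(\<lambda>x. p * f x + q * g x) \<in> L2 a b"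
proof -
  have "integrable (lebesgue_on {a..b})
      (\<lambda>x. p\<^sup>2 * (f x)\<^sup>2 + q\<^sup>2 * (g x)\<^sup>2 + 2 * p * q * (f x * g x))"
    using assms L2_mult_integrable[OF assms]
    by (intro Bochner_Integration.integrable_add integrable_mult_right) (auto simp: L2_def)
  moreover have "p\<^sup>2 * (f x)\<^sup>2 + q\<^sup>2 * (g x)\<^sup>2 + 2 * p * q * (f x * g x) = (p * f x + q * g x)\<^sup>2" for x
    by (simp add: power2_eq_square algebra_simps)
  ultimately show ?thesis using assms by (auto simp: L2_def)
qed

text \<open>The quadratic polynomial \<open>r \<mapsto> \<integral>(f - r g)\<^sup>2\<close> is nonnegative, so its
  discriminant is not positive.\<close>

lemma L2_Cauchy_Schwarz:
  assumes f: "f \<in> L2 a b" and g: "g \<in> L2 a b"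
  shows "\<bar>LINT x|lebesgue_on {a..b}. f x * g x\<bar> \<le> L2_norm a b f * L2_norm a b g"
proof -
  let ?M = "lebesgue_on {a..b}"
  define A where "A = (LINT x|?M. (g x)\<^sup>2)"
  define B where "B = (LINT x|?M. f x * g x)"
  define C where "C = (LINT x|?M. (f x)\<^sup>2)"
  have int: "integrable ?M (\<lambda>x. (f x)\<^sup>2)" "integrable ?M (\<lambda>x. (g x)\<^sup>2)"
    "integrable ?M (\<lambda>x. f x * g x)"
    using f g L2_mult_integrable[OF f g] by (auto simp: L2_def)
  have q: "0 \<le> A * r\<^sup>2 + (- 2 * B) * r + C" for r
  proof -
    have "0 \<le> (LINT x|?M. (f x - r * g x)\<^sup>2)" by simp
    also have "\<dots> = (LINT x|?M. (f x)\<^sup>2 + r\<^sup>2 * (g x)\<^sup>2 - 2 * r * (f x * g x))"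
      by (intro Bochner_Integration.integral_cong) (auto simp: power2_eq_square algebra_simps)
    also have "\<dots> = C + r\<^sup>2 * A - 2 * r * B"
      using int by (simp add: A_def B_def C_def)
    finally show ?thesis by (simp add: algebra_simps)
  qed
  have nn: "0 \<le> A" "0 \<le> C" by (simp_all add: A_def B_def C_def)
  have "B\<^sup>2 \<le> C * A"
  proof (cases "A = 0")
    case True
    \<comment> \<open>The polynomial is then affine and bounded below, so its slope vanishes.\<close>
    have "B = 0"
    proof (rule ccontr)
      assume "B \<noteq> 0"
      then have "- 2 * B * ((C + 1) / (2 * B)) = - C - 1" by (simp add: field_simps)
      then show False using q[of "(C + 1) / (2 * B)"] True by simp
    qed
    then show ?thesis using nn by simp
  next
    case False
    then have "A * (B / A)\<^sup>2 + (- 2 * B) * (B / A) + C = C - B\<^sup>2 / A"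
      by (simp add: field_simps power2_eq_square)
    then have "B\<^sup>2 / A \<le> C" using q[of "B / A"] by simp
    then show ?thesis using False nn by (simp add: field_simps)
  qed
  then have "sqrt (B\<^sup>2) \<le> sqrt (C * A)" by (rule real_sqrt_le_mono)
  then show ?thesis by (simp add: L2_norm_def real_sqrt_mult A_def B_def C_def)
qed

lemma const_in_L2_nonneg: "0 \<le> c \<Longrightarrow> (\<lambda>_. c) \<in> L2_nonneg a b"
  by (simp add: L2_nonneg_def const_in_L2)

lemma L2_nonneg_subset: "L2_nonneg a b \<subseteq> L2 a b"
  by (auto simp: L2_nonneg_def)

section \<open>Integrals over intervals\<close>

lemma LINT_derivative:
  fixes f f' :: "real \<Rightarrow> real"
  assumes "a \<le> b" "\<And>x. x \<in> {a..b} \<Longrightarrow> (f has_real_derivative f' x) (at x within {a..b})"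
    and "continuous_on {a..b} f'"
  shows "(LINT x|lebesgue_on {a..b}. f' x) = f b - f a"
proof -
  have "(f' has_integral (f b - f a)) {a..b}"
    using assms(1,2) by (intro fundamental_theorem_of_calculus) (auto simp: has_real_derivative_iff_has_vector_derivative)
  then show ?thesis
    using lebesgue_integral_eq_integral[OF continuous_imp_integrable_real[OF assms(3)]]
    by (simp add: integral_unique)
qed

lemma LINT_shift:
  fixes f :: "real \<Rightarrow> real"
  shows "(LINT x|lebesgue_on {a..b}. f (c + x)) = (LINT x|lebesgue_on {c + a..c + b}. f x)"
proof -
  have "(LINT x|lebesgue_on {c + a..c + b}. f x) = (LINT x|lebesgue. indicat_real {c + a..c + b} x *\<^sub>R f x)"
    by (rule integral_restrict_space) auto
  also have "\<dots> = (LINT x|lebesgue. indicat_real {c + a..c + b} (c + 1 * x) *\<^sub>R f (c + 1 * x))"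
    by (subst lebesgue_integral_real_affine[of 1 _ c]) auto
  also have "\<dots> = (LINT x|lebesgue. indicat_real {a..b} x *\<^sub>R f (c + x))"
    by (intro Bochner_Integration.integral_cong) (auto simp: indicator_def)
  also have "\<dots> = (LINT x|lebesgue_on {a..b}. f (c + x))"
    by (rule integral_restrict_space[symmetric]) auto
  finally show ?thesis ..
qed

lemma LINT_reflect:
  fixes f :: "real \<Rightarrow> real"
  shows "(LINT x|lebesgue_on {a..b}. f (1 - x)) = (LINT x|lebesgue_on {1 - b..1 - a}. f x)"
proof -
  have "(LINT x|lebesgue_on {1 - b..1 - a}. f x) = (LINT x|lebesgue. indicat_real {1 - b..1 - a} x *\<^sub>R f x)"
    by (rule integral_restrict_space) auto
  also have "\<dots> = (LINT x|lebesgue. indicat_real {1 - b..1 - a} (1 + (- 1) * x) *\<^sub>R f (1 + (- 1) * x))"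
    by (subst lebesgue_integral_real_affine[of "- 1" _ 1]) auto
  also have "\<dots> = (LINT x|lebesgue. indicat_real {a..b} x *\<^sub>R f (1 - x))"
    by (intro Bochner_Integration.integral_cong) (auto simp: indicator_def)
  also have "\<dots> = (LINT x|lebesgue_on {a..b}. f (1 - x))"
    by (rule integral_restrict_space[symmetric]) auto
  finally show ?thesis ..
qed

lemma measurable_reflect_unit:
  fixes f :: "real \<Rightarrow> real"
  assumes "f \<in> borel_measurable (lebesgue_on {0..1})"
  shows "(\<lambda>x. f (1 - x)) \<in> borel_measurable (lebesgue_on {0..1})"
proof -
  have "(\<lambda>x. f x * indicat_real {0..1} x) \<in> borel_measurable lebesgue"
    using assms by (subst (asm) borel_measurable_restrict_space_iff) (auto simp: mult.commute)
  from borel_measurable_affine[OF this, of "-1" 1]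
  have "(\<lambda>x. f (1 - x) * indicat_real {0..1} (1 - x)) \<in> borel_measurable lebesgue" by simp
  also have "(\<lambda>x. f (1 - x) * indicat_real {0..1} (1 - x)) = (\<lambda>x. indicat_real {0..1} x *\<^sub>R f (1 - x))"
    by (auto simp: indicator_def)
  finally show ?thesis
    by (subst borel_measurable_restrict_space_iff) auto
qed

lemma L2_reflect:
  assumes "f \<in> L2 0 1"
  shows "(\<lambda>x. f (1 - x)) \<in> L2 0 1"
proof -
  have f: "f \<in> borel_measurable (lebesgue_on {0..1})" "integrable (lebesgue_on {0..1}) (\<lambda>x. (f x)\<^sup>2)"
    using assms by (auto simp: L2_def)
  have "integrable lebesgue (\<lambda>x. indicat_real {0..1} x *\<^sub>R (f x)\<^sup>2)"
    using f(2) by (subst (asm) integrable_restrict_space) auto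
  from lebesgue_integrable_real_affine[OF this, of "-1" 1]
  have "integrable lebesgue (\<lambda>x. indicat_real {0..1} (1 - x) *\<^sub>R (f (1 - x))\<^sup>2)" by simp
  also have "(\<lambda>x. indicat_real {0..1} (1 - x) *\<^sub>R (f (1 - x))\<^sup>2) = (\<lambda>x. indicat_real {0..1} x *\<^sub>R (f (1 - x))\<^sup>2)"
    by (auto simp: indicator_def)
  finally have "integrable (lebesgue_on {0..1}) (\<lambda>x. (f (1 - x))\<^sup>2)"
    by (subst integrable_restrict_space) auto
  then show ?thesis using measurable_reflect_unit[OF f(1)] by (simp add: L2_def)
qed

lemma borel_imp_lebesgue_on:
  fixes f :: "'a::euclidean_space \<Rightarrow> real"
  shows "f \<in> borel_measurable borel \<Longrightarrow> f \<in> borel_measurable (lebesgue_on S)"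
  by (simp add: measurable_completion measurable_restrict_space1)

lemma countable_AE:
  fixes C :: "real set"
  assumes "countable C" "inj f" "S \<in> sets lebesgue"
  shows "AE x in lebesgue_on S. f x \<notin> C"
proof -
  have "countable (f -` C)" using assms
    by (metis countable_image_inj_on image_vimage_eq inj_on_subset subset_UNIV countable_subset inf_le1)
  then have "f -` C \<in> null_sets lebesgue"
    by (metis countable_imp_null_set_lborel null_sets_completionI)
  then have "AE x in lebesgue. x \<notin> f -` C" by (rule AE_not_in)
  then show ?thesis
    by (subst AE_restrict_space_iff) (auto simp: assms)
qed

lemma AE_interior: "AE x in lebesgue_on {a..b::real}. x \<in> {a<..<b}"
proof -
  have "AE x in lebesgue_on {a..b}. x \<notin> {a, b}"
    using countable_AE[of "{a, b}" "\<lambda>x. x" "{a..b}"] by simp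
  then show ?thesis using AE_space by eventually_elim auto
qed

section \<open>Wave profiles\<close>

text \<open>The one-variable functions from which solutions are built. This class contains both the
  continuous ramps and the step functions that occur below. Boundedness and continuity off a
  null set are what dominated convergence needs for translations \<open>Q (s + x)\<close> to depend
  continuously on \<open>s\<close> in \<open>L\<^sup>2\<close>; Borel measurability makes \<open>Q (t + x)\<close> jointly
  measurable in \<open>(t, x)\<close>.\<close>

definition profile :: "(real \<Rightarrow> real) \<Rightarrow> bool" where
  "profile Q \<longleftrightarrow> Q \<in> borel_measurable borel \<and> (\<exists>M. \<forall>s. \<bar>Q s\<bar> \<le> M) \<and>
     countable {s. \<not> isCont Q s}"

lemma continuous_profile:
  assumes "continuous_on UNIV Q" "\<And>s. \<bar>Q s\<bar> \<le> M"
  shows "profile Q"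
  unfolding profile_def
proof (intro conjI)
  show "Q \<in> borel_measurable borel" by (rule borel_measurable_continuous_onI[OF assms(1)])
  show "\<exists>M. \<forall>s. \<bar>Q s\<bar> \<le> M" using assms(2) by blast
  have "isCont Q s" for s using assms(1) by (simp add: continuous_on_eq_continuous_at)
  then show "countable {s. \<not> isCont Q s}" by simp
qed

lemma profile_const: "profile (\<lambda>_. c)"
  by (rule continuous_profile[of _ "\<bar>c\<bar>"]) simp_all

lemma step_profile: "profile (\<lambda>s. if s < k then a else b)"
  unfolding profile_def
proof (intro conjI)
  have "isCont (\<lambda>s. if s < k then a else b) s" if "s \<noteq> k" for s
  proof (cases "s < k")
    case True
    have "continuous_on {..<k} (\<lambda>s. if s < k then a else b) \<longleftrightarrow> continuous_on {..<k} (\<lambda>_. a)"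
      by (rule continuous_on_cong) auto
    then show ?thesis using True continuous_on_interior[of "{..<k}" "\<lambda>s. if s < k then a else b" s]
      by (simp add: interior_open)
  next
    case False
    have "continuous_on {k<..} (\<lambda>s. if s < k then a else b) \<longleftrightarrow> continuous_on {k<..} (\<lambda>_. b)"
      by (rule continuous_on_cong) auto
    then show ?thesis using False that continuous_on_interior[of "{k<..}" "\<lambda>s. if s < k then a else b" s]
      by (simp add: interior_open)
  qed
  then have "{s. \<not> isCont (\<lambda>s. if s < k then a else b) s} \<subseteq> {k}" by blast
  then show "countable {s. \<not> isCont (\<lambda>s. if s < k then a else b) s}"
    by (rule countable_subset) simp
  show "\<exists>M. \<forall>s. \<bar>if s < k then a else b\<bar> \<le> M"
    by (rule exI[of _ "max \<bar>a\<bar> \<bar>b\<bar>"]) auto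
qed simp

lemma profile_scale: "profile Q \<Longrightarrow> profile (\<lambda>s. c * Q s)"
  unfolding profile_def
proof (elim conjE exE, intro conjI)
  fix M assume "\<forall>s. \<bar>Q s\<bar> \<le> M"
  then have "\<forall>s. \<bar>c * Q s\<bar> \<le> \<bar>c\<bar> * M" by (simp add: abs_mult mult_left_mono)
  then show "\<exists>M. \<forall>s. \<bar>c * Q s\<bar> \<le> M" ..
next
  assume "countable {s. \<not> isCont Q s}"
  then show "countable {s. \<not> isCont (\<lambda>s. c * Q s) s}"
    by (rule countable_subset[rotated]) (auto intro: continuous_intros)
qed auto

lemma profile_uminus: "profile Q \<Longrightarrow> profile (\<lambda>s. - Q s)"
  using profile_scale[of Q "- 1"] by simp

lemma profile_measurable:
  assumes "profile Q"
  shows "(\<lambda>x. Q (t + x)) \<in> borel_measurable (lebesgue_on S)"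
    "(\<lambda>x. Q (t + 1 - x)) \<in> borel_measurable (lebesgue_on S)"
  using assms unfolding profile_def by (auto intro!: borel_imp_lebesgue_on)

lemma profile_bounded:
  assumes "profile Q"
  obtains M where "0 \<le> M" "\<And>s. \<bar>Q s\<bar> \<le> M"
  using assms unfolding profile_def by (meson abs_ge_zero order_trans)

lemma profile_AE:
  assumes "profile Q"
  shows "AE x in lebesgue_on {0..1}. isCont Q (t + x)" "AE x in lebesgue_on {0..1}. isCont Q (t + 1 - x)"
  using assms countable_AE[of "{s. \<not> isCont Q s}" "\<lambda>x. t + x" "{0..1}"]
    countable_AE[of "{s. \<not> isCont Q s}" "\<lambda>x. t + 1 - x" "{0..1}"]
  by (auto simp: profile_def inj_def)

lemma profile_L2: "profile Q \<Longrightarrow> (\<lambda>x. Q (t + x)) \<in> L2 a b"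
  using profile_bounded[of Q] profile_measurable(1)[of Q] by (metis bounded_in_L2)

lemma profile_integrable:
  assumes "profile Q"
  shows "integrable (lebesgue_on {a..b}) (\<lambda>x. Q (t + x))"
  using profile_L2[OF assms] by (rule L2_integrable)

lemma profile_integrable_on:
  assumes "profile Q"
  shows "Q integrable_on {a..b}"
  using profile_integrable[OF assms, of a b 0] by (simp add: integrable_on_lebesgue_on)

section \<open>D'Alembert's formula\<close>

text \<open>D'Alembert's formula: a wave with profile \<open>Q\<close> travelling to the left plus one with profile \<open>P\<close>
  travelling to the right. The argument of \<open>P\<close> is shifted by 1 so that the two waves are
  exchanged by the reflection \<open>x \<mapsto> 1 - x\<close>, and so that both profiles are evaluated at
  nonnegative points only.\<close>

definition dalembert :: "(real \<Rightarrow> real) \<Rightarrow> (real \<Rightarrow> real) \<Rightarrow> real \<Rightarrow> real \<Rightarrow> real" where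
  "dalembert Q P t x = Q (t + x) + P (t + 1 - x)"

lemma dalembert_L2:
  assumes "profile Q" "profile P"
  shows "dalembert Q P t \<in> L2 0 1"
proof -
  obtain M N where "\<And>s. \<bar>Q s\<bar> \<le> M" "\<And>s. \<bar>P s\<bar> \<le> N"
    by (metis assms profile_bounded)
  then have "\<bar>dalembert Q P t x\<bar> \<le> M + N" for x
    unfolding dalembert_def by (metis abs_triangle_ineq add_mono order_trans)
  moreover have "dalembert Q P t \<in> borel_measurable (lebesgue_on {0..1})"
    unfolding dalembert_def[abs_def] using assms by (intro borel_measurable_add profile_measurable)
  ultimately show ?thesis by (intro bounded_in_L2) auto
qed

lemma dalembert_measurable:
  assumes "profile Q" "profile P"
  shows "(\<lambda>p. dalembert Q P (fst p) (snd p)) \<in> borel_measurable (lebesgue_on S)"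
  unfolding dalembert_def using assms
  by (intro borel_imp_lebesgue_on) (auto simp: profile_def borel_prod[symmetric])

text \<open>At almost every \<open>x\<close> both profiles are continuous at the points where the formula evaluates
  them, so dominated convergence applies.\<close>

lemma dalembert_L2_continuous:
  assumes Q: "profile Q" and P: "profile P"
  shows "((\<lambda>s. L2_norm 0 1 (\<lambda>x. dalembert Q P s x - dalembert Q P t x)) \<longlongrightarrow> 0) (at t within S)"
  unfolding tendsto_at_iff_sequentially
proof (intro allI impI)
  fix X assume "\<forall>i. X i \<in> S - {t}" and X: "X \<longlonglongrightarrow> t"
  let ?M = "lebesgue_on {0..1::real}" and ?y = "dalembert Q P"
  obtain M N where MN: "\<And>s. \<bar>Q s\<bar> \<le> M" "\<And>s. \<bar>P s\<bar> \<le> N"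
    by (metis assms profile_bounded)
  have bound: "\<bar>?y s x - ?y r x\<bar> \<le> 2 * (M + N)" for s r x
    using MN(1)[of "s + x"] MN(1)[of "r + x"] MN(2)[of "s + 1 - x"] MN(2)[of "r + 1 - x"]
    unfolding dalembert_def abs_le_iff by (simp add: algebra_simps)
  have "(\<lambda>n. LINT x|?M. (?y (X n) x - ?y t x)\<^sup>2) \<longlonglongrightarrow> (LINT x|?M. (?y t x - ?y t x)\<^sup>2)"
  proof (rule integral_dominated_convergence[where w = "\<lambda>_. (2 * (M + N))\<^sup>2"])
    show "AE x in ?M. (\<lambda>n. (?y (X n) x - ?y t x)\<^sup>2) \<longlonglongrightarrow> (?y t x - ?y t x)\<^sup>2"
      using profile_AE(1)[OF Q, of t] profile_AE(2)[OF P, of t]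
    proof eventually_elim
      case (elim x)
      have "(\<lambda>n. Q (X n + x)) \<longlonglongrightarrow> Q (t + x)" "(\<lambda>n. P (X n + 1 - x)) \<longlonglongrightarrow> P (t + 1 - x)"
        by (rule isCont_tendsto_compose[OF elim(1)], intro tendsto_intros X)
          (rule isCont_tendsto_compose[OF elim(2)], intro tendsto_intros X)
      then show ?case unfolding dalembert_def by (intro tendsto_intros)
    qed
    show "AE x in ?M. norm ((?y (X n) x - ?y t x)\<^sup>2) \<le> (2 * (M + N))\<^sup>2" for n
      using bound by (simp add: square_le_of_abs_le)
  qed (use dalembert_L2[OF Q P] in \<open>auto simp: L2_def intro!: borel_measurable_power borel_measurable_diff\<close>)
  then have "(\<lambda>n. sqrt (LINT x|?M. (?y (X n) x - ?y t x)\<^sup>2)) \<longlonglongrightarrow> sqrt 0"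
    by (intro tendsto_real_sqrt) simp
  then show "((\<lambda>s. L2_norm 0 1 (\<lambda>x. ?y s x - ?y t x)) \<circ> X) \<longlonglongrightarrow> 0"
    by (simp add: L2_norm_def o_def)
qed

lemma integrable_dalembert_mult:
  assumes "profile Q" "profile P" "g \<in> L2 0 1"
  shows "integrable (lebesgue_on {0..1}) (\<lambda>x. dalembert Q P t x * g x)"
  using dalembert_L2[OF assms(1,2)] assms(3) by (rule L2_mult_integrable)

text \<open>Reflecting the right-going wave turns it into a left-going one, so that every statement about a
  d'Alembert solution reduces to statements about translates \<open>Q (t + x)\<close>.\<close>

lemma dalembert_pairing:
  assumes Q: "profile Q" and P: "profile P" and g: "g \<in> L2 0 1"
  shows "(LINT x|lebesgue_on {0..1}. dalembert Q P t x * g x) =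
         (LINT x|lebesgue_on {0..1}. Q (t + x) * g x) +
         (LINT x|lebesgue_on {0..1}. P (t + x) * g (1 - x))"
proof -
  have int: "integrable (lebesgue_on {0..1}) (\<lambda>x. Q (t + x) * g x)"
    using profile_L2[OF Q] g by (rule L2_mult_integrable)
  have "(LINT x|lebesgue_on {0..1}. dalembert Q P t x * g x) - (LINT x|lebesgue_on {0..1}. Q (t + x) * g x)
      = (LINT x|lebesgue_on {0..1}. dalembert Q P t x * g x - Q (t + x) * g x)"
    using int integrable_dalembert_mult[OF Q P g]
    by (intro Bochner_Integration.integral_diff[symmetric]) auto
  also have "\<dots> = (LINT x|lebesgue_on {0..1}. P (t + (1 - x)) * g (1 - (1 - x)))"
    by (intro Bochner_Integration.integral_cong) (auto simp: dalembert_def algebra_simps)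
  also have "\<dots> = (LINT x|lebesgue_on {0..1}. P (t + x) * g (1 - x))"
    using LINT_reflect[of 0 1 "\<lambda>x. P (t + x) * g (1 - x)"] by simp
  finally show ?thesis by simp
qed

section \<open>Weak derivatives\<close>

lemma H10_deriv_L2: "H10_deriv \<phi> g \<Longrightarrow> g \<in> L2 0 1"
  by (simp add: H10_deriv_def)

lemma H10_deriv_mean_zero:
  assumes "H10_deriv \<phi> g"
  shows "(LINT x|lebesgue_on {0..1}. g x) = 0"
  using assms by (auto simp: H10_deriv_def)

text \<open>The primitive as an integral over the fixed domain \<open>[0,1]\<close>, the form in which Fubini's theorem
  can be applied to it.\<close>

lemma H10_deriv_eq:
  assumes "H10_deriv \<psi> g" "x \<in> {0..1}"
  shows "(LINT r|lebesgue_on {0..1}. indicat_real {..x} r * g r) = \<psi> x"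
proof -
  have "(LINT r|lebesgue_on {0..1}. indicat_real {..x} r * g r) =
        (LINT r|lebesgue. indicat_real {0..1} r *\<^sub>R (indicat_real {..x} r * g r))"
    by (rule integral_restrict_space) auto
  also have "\<dots> = (LINT r|lebesgue. indicat_real {0..x} r *\<^sub>R g r)"
    using assms(2) by (intro Bochner_Integration.integral_cong) (auto simp: indicator_def)
  also have "\<dots> = (LINT r|lebesgue_on {0..x}. g r)"
    by (rule integral_restrict_space[symmetric]) auto
  finally show ?thesis using assms by (simp add: H10_deriv_def)
qed

lemma H10_deriv_lin:
  assumes "H10_deriv \<phi> g" "H10_deriv \<psi> h"
  shows "H10_deriv (\<lambda>x. a * \<phi> x + b * \<psi> x) (\<lambda>x. a * g x + b * h x)"
proof -
  have "integrable (lebesgue_on {0..x}) g" "integrable (lebesgue_on {0..x}) h" if "x \<in> {0..1}" for x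
    using integrable_subinterval[OF L2_integrable[OF H10_deriv_L2[OF assms(1)]], of 0 x]
      integrable_subinterval[OF L2_integrable[OF H10_deriv_L2[OF assms(2)]], of 0 x] that
    by simp_all
  then have "a * \<phi> x + b * \<psi> x = (LINT s|lebesgue_on {0..x}. a * g s + b * h s)" if "x \<in> {0..1}" for x
    using assms that by (simp add: H10_deriv_def)
  moreover have "(\<lambda>x. a * g x + b * h x) \<in> L2 0 1"
    using assms by (intro L2_lin H10_deriv_L2)
  moreover have "\<phi> 1 = 0" "\<psi> 1 = 0" using assms by (simp_all add: H10_deriv_def)
  ultimately show ?thesis by (simp add: H10_deriv_def)
qed

lemma H10_deriv_reflect:
  assumes "H10_deriv \<psi> g"
  shows "H10_deriv (\<lambda>x. \<psi> (1 - x)) (\<lambda>x. - g (1 - x))"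
proof -
  have g: "g \<in> L2 0 1" using assms by (rule H10_deriv_L2)
  have "\<psi> (1 - x) = (LINT s|lebesgue_on {0..x}. - g (1 - s))" if x: "x \<in> {0..1}" for x
  proof -
    have int: "integrable (lebesgue_on {c..d}) g" if "0 \<le> c" "d \<le> 1" for c d
      by (rule integrable_subinterval[OF L2_integrable[OF g]]) (use that in auto)
    have "(LINT s|lebesgue_on {0..x}. - g (1 - s)) = - (LINT s|lebesgue_on {1 - x..1}. g s)"
      using LINT_reflect[of 0 x g] by simp
    also have "\<dots> = - integral {1 - x..1} g"
      using int x by (subst lebesgue_integral_eq_integral) auto
    also have "\<dots> = integral {0..1 - x} g - integral {0..1} g"
      using Henstock_Kurzweil_Integration.integral_combine[of 0 "1 - x" 1 g] x int[of 0 1]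
      by (auto simp: integrable_on_lebesgue_on)
    also have "\<dots> = (LINT s|lebesgue_on {0..1 - x}. g s) - (LINT s|lebesgue_on {0..1}. g s)"
      using int x by (subst (1 2) lebesgue_integral_eq_integral) auto
    also have "\<dots> = \<psi> (1 - x)"
      using assms x by (auto simp: H10_deriv_def)
    finally show ?thesis ..
  qed
  moreover have "(\<lambda>x. - g (1 - x)) \<in> L2 0 1"
    using L2_lin[OF L2_reflect[OF g] L2_reflect[OF g], of "-1" 0] by simp
  moreover have "\<psi> 0 = 0"
  proof -
    have "(LINT s|lebesgue_on {0..0}. g s) = integral {0..0} g"
      using integrable_subinterval[OF L2_integrable[OF g], of 0 0]
      by (intro lebesgue_integral_eq_integral) auto
    then show ?thesis using assms by (simp add: H10_deriv_def)
  qed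
  ultimately show ?thesis
    unfolding H10_deriv_def by (intro conjI ballI) (simp_all only: diff_self)
qed

lemma H10_L2:
  assumes "H10_deriv \<psi> g"
  shows "\<psi> \<in> L2 0 1"
proof -
  have cont: "continuous_on {0..1} (\<lambda>x. LINT s|lebesgue_on {0..x}. g s)"
    using L2_integrable[OF H10_deriv_L2[OF assms]] by (rule indefinite_integral_continuous_real)
  have "\<psi> x = (LINT s|lebesgue_on {0..x}. g s)" if "x \<in> {0..1}" for x
    using assms that by (simp add: H10_deriv_def)
  then have "continuous_on {0..1} \<psi>"
    using cont by (subst continuous_on_cong) auto
  then show ?thesis by (rule continuous_in_L2)
qed

section \<open>Integration by parts against a profile\<close>

text \<open>For a merely bounded \<open>Q\<close> the pairing of \<open>Q (s + x)\<close> with an \<open>H\<^sup>1\<^sub>0\<close> function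
  can be differentiated in \<open>s\<close> only after an integration by parts, which brings in the Lipschitz
  primitive of \<open>Q\<close>.\<close>

definition primitive :: "(real \<Rightarrow> real) \<Rightarrow> real \<Rightarrow> real" where
  "primitive Q u = integral {0..u} Q"

lemma primitive_diff:
  assumes "profile Q" "0 \<le> u" "u \<le> v"
  shows "primitive Q v - primitive Q u = integral {u..v} Q"
  using Henstock_Kurzweil_Integration.integral_combine[OF assms(2,3) profile_integrable_on[OF assms(1)]]
  by (simp add: primitive_def)

lemma primitive_shift:
  assumes Q: "profile Q" and "0 \<le> t + a" "a \<le> b"
  shows "(LINT x|lebesgue_on {a..b}. Q (t + x)) = primitive Q (t + b) - primitive Q (t + a)"
proof -
  have "(LINT x|lebesgue_on {a..b}. Q (t + x)) = integral {a..b} (\<lambda>x. Q (t + x))"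
    using profile_integrable[OF Q] by (rule lebesgue_integral_eq_integral) auto
  also have "\<dots> = integral {a + t..b + t} Q"
    using integral_shift_Icc_real[of a b Q t] by (simp add: o_def)
  also have "\<dots> = primitive Q (t + b) - primitive Q (t + a)"
    using primitive_diff[OF Q, of "a + t" "b + t"] assms by (simp add: add.commute)
  finally show ?thesis .
qed

lemma primitive_lipschitz:
  assumes Q: "profile Q" and M: "\<And>s. \<bar>Q s\<bar> \<le> M" and "0 \<le> u" "0 \<le> v"
  shows "\<bar>primitive Q v - primitive Q u\<bar> \<le> M * \<bar>v - u\<bar>"
proof -
  have *: "\<bar>primitive Q v - primitive Q u\<bar> \<le> M * (v - u)" if "0 \<le> u" "u \<le> v" for u v
  proof -
    have "norm (integral {u..v} Q) \<le> integral {u..v} (\<lambda>_. M)"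
      using M by (intro integral_norm_bound_integral profile_integrable_on[OF Q]) auto
    then show ?thesis using primitive_diff[OF Q that] that by (simp add: mult.commute)
  qed
  show ?thesis
    using *[of u v] *[of v u] assms(3,4) by (cases "u \<le> v") (auto simp: abs_minus_commute)
qed

lemma primitive_measurable:
  assumes Q: "profile Q" and "0 \<le> t"
  shows "(\<lambda>x. primitive Q (t + x)) \<in> borel_measurable (lebesgue_on {0..1})"
proof (intro continuous_imp_measurable_on_sets_lebesgue)
  obtain M where M: "0 \<le> M" "\<And>s. \<bar>Q s\<bar> \<le> M" using Q profile_bounded by metis
  have "M-lipschitz_on {0..1} (\<lambda>x. primitive Q (t + x))"
  proof (rule lipschitz_onI)
    fix x y :: real assume "x \<in> {0..1}" "y \<in> {0..1}"
    then show "dist (primitive Q (t + x)) (primitive Q (t + y)) \<le> M * dist x y"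
      using primitive_lipschitz[OF Q M(2), of "t + y" "t + x"] assms(2) by (simp add: dist_real_def)
  qed (rule M)
  then show "continuous_on {0..1} (\<lambda>x. primitive Q (t + x))" by (rule lipschitz_on_continuous_on)
qed auto

lemma primitive_L2:
  assumes Q: "profile Q" and t: "0 \<le> t"
  shows "(\<lambda>x. primitive Q (t + x)) \<in> L2 0 1"
proof -
  obtain K where K: "0 \<le> K" "\<And>s. \<bar>Q s\<bar> \<le> K" using Q profile_bounded by metis
  have "\<bar>primitive Q (t + x)\<bar> \<le> K * (t + 1)" if x: "x \<in> {0..1}" for x
  proof -
    have "\<bar>primitive Q (t + x)\<bar> \<le> K * (t + x)"
      using primitive_lipschitz[OF Q K(2), of 0 "t + x"] x t by (simp add: primitive_def)
    also have "\<dots> \<le> K * (t + 1)" using K(1) x by (intro mult_left_mono) auto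
    finally show ?thesis .
  qed
  then show ?thesis by (intro bounded_in_L2 primitive_measurable[OF Q t])
qed

lemma primitive_has_derivative:
  assumes Q: "profile Q" and "isCont Q u" "0 \<le> u" "u \<le> b"
  shows "(primitive Q has_real_derivative Q u) (at u within {0..b})"
  using integral_has_vector_derivative_continuous_at[OF profile_integrable_on[OF Q], of u 0 b "{}"] assms
  by (auto simp: primitive_def[abs_def] has_real_derivative_iff_has_vector_derivative
      intro: continuous_at_imp_continuous_at_within)

text \<open>Since \<open>\<psi>\<close> is only absolutely continuous, the formula is obtained from Fubini's theorem for
  \<open>Q (t + x) g(r)\<close> on the triangle \<open>r \<le> x\<close>. There is no boundary term at \<open>x = 1\<close>
  because \<open>g\<close> has mean zero.\<close>

lemma H10_integration_by_parts:
  assumes Q: "profile Q" and \<psi>: "H10_deriv \<psi> g" and t: "0 \<le> t"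
  shows "(LINT x|lebesgue_on {0..1}. Q (t + x) * \<psi> x) =
         - (LINT x|lebesgue_on {0..1}. primitive Q (t + x) * g x)"
proof -
  let ?M = "lebesgue_on {0..1::real}"
  interpret M: finite_measure ?M
    by (rule finite_measure_lebesgue_on) auto
  interpret pair_sigma_finite ?M ?M ..
  obtain K where K: "0 \<le> K" "\<And>s. \<bar>Q s\<bar> \<le> K" using Q profile_bounded by metis
  have g: "integrable ?M g" and g_meas: "g \<in> borel_measurable ?M"
    using L2_integrable[OF H10_deriv_L2[OF \<psi>]] by auto
  have Q_meas: "(\<lambda>x. Q (t + x)) \<in> borel_measurable ?M" by (rule profile_measurable[OF Q])
  have id_meas: "(\<lambda>x::real. x) \<in> borel_measurable ?M" by (rule borel_imp_lebesgue_on) simp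
  \<comment> \<open>Integrating \<open>F\<close> first in \<open>r\<close> gives \<open>Q (t + x) \<psi>(x)\<close>, first in \<open>x\<close> an increment of the
    primitive times \<open>g\<close>.\<close>
  define F where "F x r = Q (t + x) * indicat_real {..x} r * g r" for x r
  have meas: "case_prod F \<in> borel_measurable (?M \<Otimes>\<^sub>M ?M)"
  proof -
    have meas: "(\<lambda>p. g (snd p)) \<in> borel_measurable (?M \<Otimes>\<^sub>M ?M)"
      "(\<lambda>p. Q (t + fst p)) \<in> borel_measurable (?M \<Otimes>\<^sub>M ?M)"
      "(\<lambda>p. fst p) \<in> borel_measurable (?M \<Otimes>\<^sub>M ?M)" "(\<lambda>p. snd p) \<in> borel_measurable (?M \<Otimes>\<^sub>M ?M)"
      by (rule measurable_compose[OF measurable_snd], fact,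
          rule measurable_compose[OF measurable_fst], fact,
          rule measurable_compose[OF measurable_fst], fact,
          rule measurable_compose[OF measurable_snd], fact)
    have "case_prod F = (\<lambda>p. Q (t + fst p) * (if snd p \<le> fst p then 1 else 0) * g (snd p))"
      by (auto simp: F_def indicator_def)
    moreover have "{p \<in> space (?M \<Otimes>\<^sub>M ?M). snd p \<le> fst p} \<in> sets (?M \<Otimes>\<^sub>M ?M)"
      using meas(4,3) by (rule borel_measurable_le)
    then have "(\<lambda>p. if snd p \<le> fst p then 1 else 0 :: real) \<in> borel_measurable (?M \<Otimes>\<^sub>M ?M)"
      by (intro measurable_If) auto
    ultimately show ?thesis using meas(1,2) by (simp only: borel_measurable_times)
  qed
  have intF: "integrable (?M \<Otimes>\<^sub>M ?M) (case_prod F)"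
  proof (rule Bochner_Integration.integrable_bound)
    show "integrable (?M \<Otimes>\<^sub>M ?M) (\<lambda>(x, r). K * g r)"
      by (rule Fubini_integrable) (use g in \<open>auto intro!: integrable_mult_right\<close>)
    have "\<bar>F x r\<bar> \<le> \<bar>K * g r\<bar>" for x r
      using K(2)[of "t + x"] K(1) by (auto simp: F_def abs_mult indicator_def intro!: mult_right_mono)
    then show "AE p in ?M \<Otimes>\<^sub>M ?M. norm (case_prod F p) \<le> norm (case p of (x, r) \<Rightarrow> K * g r)"
      by (auto intro!: AE_I2)
  qed (rule meas)
  have "(LINT x|?M. Q (t + x) * \<psi> x) = (LINT x|?M. LINT r|?M. F x r)"
  proof (rule Bochner_Integration.integral_cong)
    fix x assume "x \<in> space ?M"
    then have "x \<in> {0..1}" by simp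
    then show "Q (t + x) * \<psi> x = (LINT r|?M. F x r)"
      using H10_deriv_eq[OF \<psi>, of x] by (simp add: F_def mult.assoc)
  qed simp
  also have "\<dots> = (LINT r|?M. LINT x|?M. F x r)"
    by (rule Fubini_integral[OF intF, symmetric])
  also have "\<dots> = (LINT r|?M. primitive Q (t + 1) * g r - primitive Q (t + r) * g r)"
  proof (rule Bochner_Integration.integral_cong)
    fix r assume "r \<in> space ?M"
    then have r: "0 \<le> r" "r \<le> 1" by auto
    have "(LINT x|?M. F x r) = (LINT x|lebesgue. indicat_real {0..1} x *\<^sub>R F x r)"
      by (rule integral_restrict_space) auto
    also have "\<dots> = (LINT x|lebesgue. (indicat_real {r..1} x *\<^sub>R Q (t + x)) * g r)"
      using r by (intro Bochner_Integration.integral_cong) (auto simp: indicator_def F_def)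
    also have "\<dots> = (LINT x|lebesgue. indicat_real {r..1} x *\<^sub>R Q (t + x)) * g r"
      by simp
    also have "(LINT x|lebesgue. indicat_real {r..1} x *\<^sub>R Q (t + x)) = (LINT x|lebesgue_on {r..1}. Q (t + x))"
      by (rule integral_restrict_space[symmetric]) auto
    also have "\<dots> = primitive Q (t + 1) - primitive Q (t + r)"
      using r t by (intro primitive_shift[OF Q]) auto
    finally show "(LINT x|?M. F x r) = primitive Q (t + 1) * g r - primitive Q (t + r) * g r"
      by (simp add: algebra_simps)
  qed simp
  also have "\<dots> = (LINT r|?M. primitive Q (t + 1) * g r) - (LINT r|?M. primitive Q (t + r) * g r)"
  proof (rule Bochner_Integration.integral_diff)
    show "integrable ?M (\<lambda>r. primitive Q (t + r) * g r)"
      using primitive_L2[OF Q t] H10_deriv_L2[OF \<psi>] by (rule L2_mult_integrable)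
  qed (use g in simp)
  also have "(LINT r|?M. primitive Q (t + 1) * g r) = 0"
    using H10_deriv_mean_zero[OF \<psi>] by simp
  finally show ?thesis by simp
qed

text \<open>Differentiation under the integral: the difference quotients of the primitive are bounded by
  \<open>sup \<bar>Q\<bar>\<close> and converge to \<open>Q (t + x)\<close> wherever \<open>Q\<close> is continuous.\<close>

lemma primitive_pairing_derivative:
  assumes Q: "profile Q" and g: "g \<in> L2 0 1" and t: "t \<in> {0..T}"
  shows "((\<lambda>s. LINT x|lebesgue_on {0..1}. primitive Q (s + x) * g x) has_real_derivative
          (LINT x|lebesgue_on {0..1}. Q (t + x) * g x)) (at t within {0..T})"
  unfolding has_field_derivative_iff tendsto_at_iff_sequentially
proof (intro allI impI)
  fix X assume X: "\<forall>i. X i \<in> {0..T} - {t}" and lim: "X \<longlonglongrightarrow> t"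
  let ?M = "lebesgue_on {0..1::real}" and ?R = "primitive Q"
  obtain K where K: "0 \<le> K" "\<And>s. \<bar>Q s\<bar> \<le> K" using Q profile_bounded by metis
  have gi: "integrable ?M g" using g by (rule L2_integrable)
  have Rg: "integrable ?M (\<lambda>x. ?R (s + x) * g x)" if "0 \<le> s" for s
    using primitive_L2[OF Q that] g by (rule L2_mult_integrable)
  let ?q = "\<lambda>n x. (?R (X n + x) - ?R (t + x)) / (X n - t)"
  have "(\<lambda>n. LINT x|?M. ?q n x * g x) \<longlonglongrightarrow> (LINT x|?M. Q (t + x) * g x)"
  proof (rule integral_dominated_convergence[where w = "\<lambda>x. K * \<bar>g x\<bar>"])
    show "(\<lambda>x. Q (t + x) * g x) \<in> borel_measurable ?M"
      using gi profile_measurable[OF Q] by (intro borel_measurable_times) auto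
    show "(\<lambda>x. ?q n x * g x) \<in> borel_measurable ?M" for n
      using gi primitive_measurable[OF Q] t X
      by (intro borel_measurable_times borel_measurable_divide borel_measurable_diff) auto
    show "integrable ?M (\<lambda>x. K * \<bar>g x\<bar>)" using gi by simp
    show "AE x in ?M. (\<lambda>n. ?q n x * g x) \<longlonglongrightarrow> Q (t + x) * g x"
      using profile_AE(1)[OF Q, of t] AE_space
    proof eventually_elim
      case (elim x)
      then have x: "0 \<le> x" "x \<le> 1" by auto
      have "(?R has_real_derivative Q (t + x)) (at (t + x) within {0..T + 1})"
        using primitive_has_derivative[OF Q elim(1), of "T + 1"] x t by simp
      moreover have "\<forall>n. X n + x \<in> {0..T + 1} - {t + x}"
      proof
        fix n
        have "0 \<le> X n" "X n \<le> T" "X n \<noteq> t" using X by auto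
        then show "X n + x \<in> {0..T + 1} - {t + x}" using x by simp
      qed
      moreover have "(\<lambda>n. X n + x) \<longlonglongrightarrow> t + x"
        using lim by (rule tendsto_add[OF _ tendsto_const])
      ultimately have "((\<lambda>u. (?R u - ?R (t + x)) / (u - (t + x))) \<circ> (\<lambda>n. X n + x)) \<longlonglongrightarrow> Q (t + x)"
        unfolding has_field_derivative_iff tendsto_at_iff_sequentially
        by (elim allE[where x = "\<lambda>n. X n + x"] impE)
      then have "(\<lambda>n. ?q n x) \<longlonglongrightarrow> Q (t + x)"
        by (simp only: o_def add_diff_cancel_right)
      then show ?case by (rule tendsto_mult_right)
    qed
    show "AE x in ?M. norm (?q n x * g x) \<le> K * \<bar>g x\<bar>" for n
    proof (rule AE_I2)
      fix x assume "x \<in> space ?M"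
      then have "0 \<le> t + x" "0 \<le> X n + x" using X t by auto
      from primitive_lipschitz[OF Q K(2) this]
      have "\<bar>?R (X n + x) - ?R (t + x)\<bar> \<le> K * \<bar>X n - t\<bar>" by simp
      moreover have "\<bar>X n - t\<bar> > 0" using X by auto
      ultimately have "\<bar>?q n x\<bar> \<le> K" unfolding abs_divide by (subst pos_divide_le_eq)
      then have "\<bar>?q n x\<bar> * \<bar>g x\<bar> \<le> K * \<bar>g x\<bar>" by (rule mult_right_mono) simp
      then show "norm (?q n x * g x) \<le> K * \<bar>g x\<bar>" by (simp only: real_norm_def abs_mult)
    qed
  qed
  moreover have "(LINT x|?M. ?q n x * g x) =
      ((LINT x|?M. ?R (X n + x) * g x) - (LINT x|?M. ?R (t + x) * g x)) / (X n - t)" for n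
  proof -
    have "(LINT x|?M. ?q n x * g x) = (LINT x|?M. (?R (X n + x) * g x - ?R (t + x) * g x) / (X n - t))"
      by (intro Bochner_Integration.integral_cong) (simp_all only: left_diff_distrib times_divide_eq_left)
    also have "\<dots> = (LINT x|?M. ?R (X n + x) * g x - ?R (t + x) * g x) / (X n - t)"
      by simp
    also have "(LINT x|?M. ?R (X n + x) * g x - ?R (t + x) * g x) =
        (LINT x|?M. ?R (X n + x) * g x) - (LINT x|?M. ?R (t + x) * g x)"
      using Rg X t by (intro Bochner_Integration.integral_diff) auto
    finally show ?thesis .
  qed
  ultimately show "((\<lambda>s. ((LINT x|?M. ?R (s + x) * g x) - (LINT x|?M. ?R (t + x) * g x)) / (s - t)) \<circ> X)
      \<longlonglongrightarrow> (LINT x|?M. Q (t + x) * g x)"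
    by (simp only: o_def)
qed

section \<open>The velocity of a d'Alembert solution\<close>

text \<open>The weak form of \<open>y\<^sub>t = \<partial>\<^sub>x (Q (t + x) - P (t + 1 - x))\<close>: the time derivative of a
  d'Alembert solution is the space derivative of the solution with \<open>P\<close> replaced by \<open>- P\<close>.\<close>

lemma dalembert_pairing_derivative:
  assumes Q: "profile Q" and P: "profile P" and \<psi>: "H10_deriv \<psi> g" and t: "t \<in> {0..T}"
  shows "((\<lambda>s. LINT x|lebesgue_on {0..1}. dalembert Q P s x * \<psi> x) has_real_derivative
     - (LINT x|lebesgue_on {0..1}. dalembert Q (\<lambda>s. - P s) t x * g x)) (at t within {0..T})"
proof (rule has_field_derivative_transform_within)
  let ?M = "lebesgue_on {0..1::real}"
  let ?h = "\<lambda>x. - g (1 - x)"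
  note \<psi>' = H10_deriv_reflect[OF \<psi>]
  show "((\<lambda>s. - (LINT x|?M. primitive Q (s + x) * g x) - (LINT x|?M. primitive P (s + x) * ?h x))
      has_real_derivative - (LINT x|?M. dalembert Q (\<lambda>s. - P s) t x * g x)) (at t within {0..T})"
  proof (rule DERIV_cong)
    show "((\<lambda>s. - (LINT x|?M. primitive Q (s + x) * g x) - (LINT x|?M. primitive P (s + x) * ?h x))
      has_real_derivative - (LINT x|?M. Q (t + x) * g x) - (LINT x|?M. P (t + x) * ?h x)) (at t within {0..T})"
      by (intro DERIV_diff DERIV_minus primitive_pairing_derivative Q P t H10_deriv_L2[OF \<psi>] H10_deriv_L2[OF \<psi>'])
    show "- (LINT x|?M. Q (t + x) * g x) - (LINT x|?M. P (t + x) * ?h x) =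
        - (LINT x|?M. dalembert Q (\<lambda>s. - P s) t x * g x)"
      using dalembert_pairing[OF Q profile_uminus[OF P] H10_deriv_L2[OF \<psi>], of t] by simp
  qed
  show "- (LINT x|?M. primitive Q (s + x) * g x) - (LINT x|?M. primitive P (s + x) * ?h x) =
      (LINT x|?M. dalembert Q P s x * \<psi> x)" if "s \<in> {0..T}" for s
    using dalembert_pairing[OF Q P H10_L2[OF \<psi>], of s] that
      H10_integration_by_parts[OF Q \<psi>, of s] H10_integration_by_parts[OF P \<psi>', of s] by simp
qed (use t in \<open>auto intro: zero_less_one\<close>)

text \<open>The velocity \<open>y\<^sub>t\<close> as a functional on \<open>H\<^sup>1\<^sub>0\<close>. The weak derivative of \<open>\<psi>\<close> is
  determined up to a null set only, hence the choice of one.\<close>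

definition dalembert_velocity ::
  "(real \<Rightarrow> real) \<Rightarrow> (real \<Rightarrow> real) \<Rightarrow> real \<Rightarrow> (real \<Rightarrow> real) \<Rightarrow> real" where
  "dalembert_velocity Q P t \<psi> =
     - (LINT x|lebesgue_on {0..1}. dalembert Q (\<lambda>s. - P s) t x * (SOME g. H10_deriv \<psi> g) x)"

text \<open>The choice of the weak derivative is immaterial because, for every choice, the right-hand side is
  the derivative of the same function of time.\<close>

lemma dalembert_velocity_eq:
  assumes Q: "profile Q" and P: "profile P" and \<psi>: "H10_deriv \<psi> g" and t: "0 \<le> t"
  shows "dalembert_velocity Q P t \<psi> = - (LINT x|lebesgue_on {0..1}. dalembert Q (\<lambda>s. - P s) t x * g x)"
proof -
  have "H10_deriv \<psi> (SOME g. H10_deriv \<psi> g)"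
    by (rule someI[where P = "\<lambda>g. H10_deriv \<psi> g", OF \<psi>])
  from dalembert_pairing_derivative[OF Q P this, of t "t + 1"] dalembert_pairing_derivative[OF Q P \<psi>, of t "t + 1"]
  show ?thesis
    unfolding dalembert_velocity_def has_real_derivative_iff_has_vector_derivative
    by (intro vector_derivative_unique_within[of t "{0..t + 1}"])
      (use t in \<open>auto simp: at_within_Icc_at_right trivial_limit_within islimpt_Icc\<close>)
qed

text \<open>If the two profiles differ by a constant, the velocity pairs a constant with a weak derivative,
  which has mean zero.\<close>

lemma dalembert_velocity_zero:
  assumes Q: "profile Q" and P: "profile P" and t: "0 \<le> t"
    and c: "\<And>x. x \<in> {0<..<1} \<Longrightarrow> Q (t + x) - P (t + 1 - x) = c" and \<psi>: "\<psi> \<in> H10"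
  shows "dalembert_velocity Q P t \<psi> = 0"
proof -
  obtain g where g: "H10_deriv \<psi> g" using \<psi> by (auto simp: H10_def)
  note Y = integrable_dalembert_mult[OF Q profile_uminus[OF P] H10_deriv_L2[OF g], of t]
  have "(LINT x|lebesgue_on {0..1}. dalembert Q (\<lambda>s. - P s) t x * g x) =
      (LINT x|lebesgue_on {0..1}. c * g x)"
  proof (rule integral_cong_AE)
    show "AE x in lebesgue_on {0..1}. dalembert Q (\<lambda>s. - P s) t x * g x = c * g x"
      using AE_interior by eventually_elim (simp add: dalembert_def c[symmetric])
  qed (use Y H10_deriv_L2[OF g] in \<open>auto simp: L2_def\<close>)
  then show ?thesis
    using H10_deriv_mean_zero[OF g] by (simp add: dalembert_velocity_eq[OF Q P g t])
qed

lemma dalembert_velocity_Hm1: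
  assumes Q: "profile Q" and P: "profile P" and t: "0 \<le> t"
  shows "dalembert_velocity Q P t \<in> Hm1"
  unfolding Hm1_def
proof (intro CollectI conjI ballI allI exI)
  note eq = dalembert_velocity_eq[OF Q P _ t]
  let ?Y = "dalembert Q (\<lambda>s. - P s) t"
  note P' = profile_uminus[OF P]
  fix \<phi> \<psi> :: "real \<Rightarrow> real" and a b assume "\<phi> \<in> H10" "\<psi> \<in> H10"
  then obtain g h where gh: "H10_deriv \<phi> g" "H10_deriv \<psi> h" by (auto simp: H10_def)
  have int: "integrable (lebesgue_on {0..1}) (\<lambda>x. ?Y x * g x)" "integrable (lebesgue_on {0..1}) (\<lambda>x. ?Y x * h x)"
    using gh[THEN H10_deriv_L2] by (auto intro: integrable_dalembert_mult[OF Q P'])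
  have "(LINT x|lebesgue_on {0..1}. ?Y x * (a * g x + b * h x)) =
      (LINT x|lebesgue_on {0..1}. a * (?Y x * g x) + b * (?Y x * h x))"
    by (intro Bochner_Integration.integral_cong) (simp_all add: algebra_simps)
  also have "\<dots> = a * (LINT x|lebesgue_on {0..1}. ?Y x * g x) + b * (LINT x|lebesgue_on {0..1}. ?Y x * h x)"
    using int by simp
  finally show "dalembert_velocity Q P t (\<lambda>x. a * \<phi> x + b * \<psi> x) =
      a * dalembert_velocity Q P t \<phi> + b * dalembert_velocity Q P t \<psi>"
    by (simp add: eq[OF gh(1)] eq[OF gh(2)] eq[OF H10_deriv_lin[OF gh]])
next
  show "Hm1_bound (dalembert_velocity Q P t) (L2_norm 0 1 (dalembert Q (\<lambda>s. - P s) t))"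
    unfolding Hm1_bound_def
    using L2_Cauchy_Schwarz[OF dalembert_L2[OF Q profile_uminus[OF P]] H10_deriv_L2]
    by (simp add: dalembert_velocity_eq[OF Q P _ t])
qed

text \<open>By Cauchy--Schwarz the \<open>H\<^sup>-\<^sup>1\<close> norm of the velocity increment is at most the \<open>L\<^sup>2\<close>
  norm of an increment of \<open>dalembert Q (\<lambda>s. - P s)\<close>.\<close>

lemma dalembert_velocity_continuous:
  assumes Q: "profile Q" and P: "profile P"
  shows "Hm1_continuous T (dalembert_velocity Q P)"
  unfolding Hm1_continuous_def
proof (intro ballI conjI allI impI)
  fix t assume t: "t \<in> {0..T}"
  then show "dalembert_velocity Q P t \<in> Hm1" using dalembert_velocity_Hm1[OF Q P] by simp
  fix \<epsilon> :: real assume "0 < \<epsilon>"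
  let ?Y = "dalembert Q (\<lambda>s. - P s)"
  note P' = profile_uminus[OF P]
  have "\<forall>\<^sub>F s in at t within {0..T}. L2_norm 0 1 (\<lambda>x. ?Y s x - ?Y t x) < \<epsilon>"
    using dalembert_L2_continuous[OF Q P'] \<open>0 < \<epsilon>\<close> by (rule order_tendstoD(2))
  moreover have "\<forall>\<^sub>F s in at t within {0..T}. s \<in> {0..T}"
    by (auto simp: eventually_at_filter)
  ultimately show "\<forall>\<^sub>F s in at t within {0..T}.
      Hm1_bound (\<lambda>\<phi>. dalembert_velocity Q P s \<phi> - dalembert_velocity Q P t \<phi>) \<epsilon>"
  proof eventually_elim
    case (elim s)
    show ?case unfolding Hm1_bound_def
    proof (intro allI impI)
      fix \<phi> g assume \<phi>: "H10_deriv \<phi> g"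
      note g = H10_deriv_L2[OF \<phi>]
      have diff: "(\<lambda>x. ?Y s x - ?Y t x) \<in> L2 0 1"
        using L2_lin[OF dalembert_L2[OF Q P', of s] dalembert_L2[OF Q P', of t], of 1 "- 1"] by simp
      have "dalembert_velocity Q P s \<phi> - dalembert_velocity Q P t \<phi> =
          - ((LINT x|lebesgue_on {0..1}. ?Y s x * g x) - (LINT x|lebesgue_on {0..1}. ?Y t x * g x))"
        using elim(2) t by (simp add: dalembert_velocity_eq[OF Q P \<phi>])
      also have "\<dots> = - (LINT x|lebesgue_on {0..1}. ?Y s x * g x - ?Y t x * g x)"
        using integrable_dalembert_mult[OF Q P' g] by simp
      also have "\<dots> = - (LINT x|lebesgue_on {0..1}. (?Y s x - ?Y t x) * g x)"
        by (simp only: left_diff_distrib)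
      finally have "\<bar>dalembert_velocity Q P s \<phi> - dalembert_velocity Q P t \<phi>\<bar> \<le>
          L2_norm 0 1 (\<lambda>x. ?Y s x - ?Y t x) * L2_norm 0 1 g"
        using L2_Cauchy_Schwarz[OF diff g] by simp
      also have "\<dots> \<le> \<epsilon> * L2_norm 0 1 g"
        using elim(1) by (intro mult_right_mono) (auto simp: L2_norm_def)
      finally show "\<bar>dalembert_velocity Q P s \<phi> - dalembert_velocity Q P t \<phi>\<bar> \<le> \<epsilon> * L2_norm 0 1 g" .
    qed
  qed
qed

section \<open>Transport along characteristics\<close>

text \<open>A function \<open>w\<close> with \<open>w\<^sub>t = w\<^sub>x = d\<close> continuous is totally differentiable on the rectangle,
  including its sides, which is what the chain rule along characteristics requires.\<close>

lemma transport_has_derivative: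
  fixes w d :: "real \<Rightarrow> real \<Rightarrow> real"
  assumes dt: "\<And>t x. t \<in> A \<Longrightarrow> x \<in> B \<Longrightarrow> ((\<lambda>s. w s x) has_real_derivative d t x) (at t within A)"
    and dx: "\<And>t x. t \<in> A \<Longrightarrow> x \<in> B \<Longrightarrow> ((\<lambda>r. w t r) has_real_derivative d t x) (at x within B)"
    and cont: "continuous_on (A \<times> B) (\<lambda>p. d (fst p) (snd p))"
    and B: "convex B" and p: "t \<in> A" "x \<in> B"
  shows "((\<lambda>p. w (fst p) (snd p)) has_derivative (\<lambda>v. d t x * (fst v + snd v))) (at (t, x) within A \<times> B)"
proof -
  have "((\<lambda>(s, r). w s r) has_derivative (\<lambda>(a, b). d t x * a + blinfun_mult_right (d t x) b)) (at (t, x) within A \<times> B)"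
  proof (rule has_derivative_partialsI[OF _ _ _ p(2) B, where fy = "\<lambda>t x. blinfun_mult_right (d t x)"])
    show "((\<lambda>s. w s x) has_derivative (*) (d t x)) (at t within A)"
      using dt[OF p] by (simp add: has_field_derivative_def)
    show "((\<lambda>r. w s r) has_derivative blinfun_apply (blinfun_mult_right (d s y))) (at y within B)"
      if "s \<in> A" "y \<in> B" for s y
      using dx[OF that] by (simp add: has_field_derivative_def)
    have "continuous (at (t, x) within A \<times> B) (\<lambda>p. d (fst p) (snd p))"
      using cont p by (simp add: continuous_on_eq_continuous_within)
    then show "continuous (at (t, x) within A \<times> B) (\<lambda>(s, y). blinfun_mult_right (d s y))"
      unfolding case_prod_beta'
      by (rule bounded_linear.continuous[OF bounded_linear_blinfun_mult_right])
  qed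
  then show ?thesis by (simp add: case_prod_beta' distrib_left)
qed

text \<open>Along the segment joining the two points the chain rule gives derivative
  \<open>d ((t' - t) + (x' - x)) = 0\<close>.\<close>

lemma transport_constant_on_characteristics:
  fixes w d :: "real \<Rightarrow> real \<Rightarrow> real"
  assumes dw: "\<And>t x. t \<in> A \<Longrightarrow> x \<in> B \<Longrightarrow>
      ((\<lambda>p. w (fst p) (snd p)) has_derivative (\<lambda>v. d t x * (fst v + snd v))) (at (t, x) within A \<times> B)"
    and AB: "convex A" "convex B"
    and p: "t \<in> A" "x \<in> B" "t' \<in> A" "x' \<in> B" "t + x = t' + x'"
  shows "w t x = w t' x'"
proof -
  define \<gamma> where "\<gamma> u = (t + u * (t' - t), x + u * (x' - x))" for u
  have \<gamma>: "fst (\<gamma> u) \<in> A" "snd (\<gamma> u) \<in> B" if "u \<in> {0..1}" for u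
    using convexD_alt[OF AB(1) p(1,3), of u] convexD_alt[OF AB(2) p(2,4), of u] that
    by (auto simp: \<gamma>_def algebra_simps)
  have "((\<lambda>u. w (fst (\<gamma> u)) (snd (\<gamma> u))) has_real_derivative 0) (at u within {0..1})" if u: "u \<in> {0..1}" for u
  proof -
    have 1: "(\<gamma> has_derivative (\<lambda>h. (h * (t' - t), h * (x' - x)))) (at u within {0..1})"
      unfolding \<gamma>_def by (auto intro!: derivative_eq_intros)
    have 2: "((\<lambda>p. w (fst p) (snd p)) has_derivative (\<lambda>v. d (fst (\<gamma> u)) (snd (\<gamma> u)) * (fst v + snd v)))
        (at (\<gamma> u) within \<gamma> ` {0..1})"
      using dw[OF \<gamma>[OF u]] unfolding prod.collapse
      by (rule has_derivative_subset) (rule image_subsetI, simp only: mem_Times_iff \<gamma> simp_thms)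
    have "(\<lambda>h. d (fst (\<gamma> u)) (snd (\<gamma> u)) * (h * (t' - t) + h * (x' - x))) = (*) 0"
    proof
      fix h
      have "h * (t' - t) + h * (x' - x) = h * ((t' + x') - (t + x))" by (simp add: algebra_simps)
      then show "d (fst (\<gamma> u)) (snd (\<gamma> u)) * (h * (t' - t) + h * (x' - x)) = 0 * h" using p(5) by simp
    qed
    then show ?thesis
      using has_derivative_in_compose[OF 1 2] by (simp add: has_field_derivative_def)
  qed
  then have "\<exists>c. \<forall>u\<in>{0..1}. w (fst (\<gamma> u)) (snd (\<gamma> u)) = c"
    by (intro has_field_derivative_zero_constant) auto
  then have "w (fst (\<gamma> 0)) (snd (\<gamma> 0)) = w (fst (\<gamma> 1)) (snd (\<gamma> 1))" by force
  then show ?thesis by (simp add: \<gamma>_def)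
qed

text \<open>The conservation law behind the transposition identity. Formally \<open>Q (t + x) w\<close> again solves
  \<open>f\<^sub>t = f\<^sub>x\<close>, so its integral over \<open>(0,1)\<close> changes by the flux through the two ends.
  As \<open>Q\<close> is not differentiable, the proof uses instead that \<open>w t x = W (t + x)\<close>, so that all four
  integrals are integrals of the single function \<open>Q W\<close> over subintervals of \<open>[0, \<tau> + 1]\<close>.\<close>

lemma transport_balance:
  fixes w d :: "real \<Rightarrow> real \<Rightarrow> real"
  assumes Q: "profile Q" and \<tau>: "\<tau> \<in> {0..T}"
    and dw: "\<And>t x. t \<in> {0..T} \<Longrightarrow> x \<in> {0..1} \<Longrightarrow>
      ((\<lambda>p. w (fst p) (snd p)) has_derivative (\<lambda>v. d t x * (fst v + snd v))) (at (t, x) within {0..T} \<times> {0..1})"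
  shows "(LINT x|lebesgue_on {0..1}. Q (\<tau> + x) * w \<tau> x) =
         (LINT x|lebesgue_on {0..1}. Q x * w 0 x) +
         (LINT t|lebesgue_on {0..\<tau>}. Q (t + 1) * w t 1 - Q t * w t 0)"
proof -
  \<comment> \<open>Follow the characteristic through \<open>(t, x)\<close> to the side \<open>x = 0\<close> if it gets there before time
    \<open>\<tau>\<close>, and to time \<open>\<tau>\<close> otherwise.\<close>
  define W where "W s = w (min s \<tau>) (max 0 (s - \<tau>))" for s
  have W: "w t x = W (t + x)" if "t \<in> {0..\<tau>}" "x \<in> {0..1}" for t x
    unfolding W_def
    by (rule transport_constant_on_characteristics[OF dw]) (use that \<tau> in \<open>auto simp: min_def max_def\<close>)
  have "continuous_on ({0..T} \<times> {0..1}) (\<lambda>p. w (fst p) (snd p))"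
    unfolding continuous_on_eq_continuous_within
  proof
    fix p assume p: "p \<in> {0..T} \<times> {0..1::real}"
    then show "continuous (at p within {0..T} \<times> {0..1}) (\<lambda>p. w (fst p) (snd p))"
      using has_derivative_continuous[OF dw[of "fst p" "snd p"]] by (simp add: mem_Times_iff)
  qed
  then have "continuous_on {0..\<tau> + 1} (\<lambda>s. w (fst (min s \<tau>, max 0 (s - \<tau>))) (snd (min s \<tau>, max 0 (s - \<tau>))))"
    by (rule continuous_on_compose2) (use \<tau> in \<open>auto intro!: continuous_intros\<close>)
  then have contW: "continuous_on {0..\<tau> + 1} W" by (simp add: W_def[abs_def])
  let ?F = "\<lambda>s. Q s * W s" and ?I = "\<lambda>a b. LINT s|lebesgue_on {a..b}. Q s * W s"
  have int: "integrable (lebesgue_on {0..\<tau> + 1}) ?F"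
    using profile_L2[OF Q, of 0] continuous_in_L2[OF contW] by (simp add: L2_mult_integrable)
  note sub = integrable_subinterval[OF int]
  have "(LINT t|lebesgue_on {0..\<tau>}. Q (t + 1) * w t 1 - Q t * w t 0) =
      (LINT t|lebesgue_on {0..\<tau>}. ?F (1 + t) - ?F (0 + t))"
    by (intro Bochner_Integration.integral_cong) (auto simp: W add.commute)
  also have "\<dots> = (LINT t|lebesgue_on {0..\<tau>}. ?F (1 + t)) - (LINT t|lebesgue_on {0..\<tau>}. ?F (0 + t))"
  proof (rule Bochner_Integration.integral_diff)
    have "continuous_on {0..\<tau>} (\<lambda>t. W (1 + t))"
      by (rule continuous_on_compose2[OF contW]) (auto intro!: continuous_intros)
    then show "integrable (lebesgue_on {0..\<tau>}) (\<lambda>t. ?F (1 + t))"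
      by (intro L2_mult_integrable profile_L2[OF Q] continuous_in_L2)
    show "integrable (lebesgue_on {0..\<tau>}) (\<lambda>t. ?F (0 + t))"
      using sub[of 0 \<tau>] by simp
  qed
  also have "\<dots> = ?I 1 (\<tau> + 1) - ?I 0 \<tau>"
    unfolding LINT_shift[where f = ?F] by (simp add: add.commute[of 1 \<tau>])
  finally have flux: "(LINT t|lebesgue_on {0..\<tau>}. Q (t + 1) * w t 1 - Q t * w t 0) = ?I 1 (\<tau> + 1) - ?I 0 \<tau>" .
  have "(LINT x|lebesgue_on {0..1}. Q (\<tau> + x) * w \<tau> x) = (LINT x|lebesgue_on {0..1}. ?F (\<tau> + x))"
    using \<tau> by (intro Bochner_Integration.integral_cong) (auto simp: W)
  also have "\<dots> = ?I \<tau> (\<tau> + 1)" unfolding LINT_shift[where f = ?F] by simp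
  finally have late: "(LINT x|lebesgue_on {0..1}. Q (\<tau> + x) * w \<tau> x) = ?I \<tau> (\<tau> + 1)" .
  have early: "(LINT x|lebesgue_on {0..1}. Q x * w 0 x) = ?I 0 1"
    using \<tau> by (intro Bochner_Integration.integral_cong) (auto simp: W)
  have "?I 0 (\<tau> + 1) = ?I 0 \<tau> + ?I \<tau> (\<tau> + 1)" "?I 0 (\<tau> + 1) = ?I 0 1 + ?I 1 (\<tau> + 1)"
    using \<tau> by (auto intro!: integral_combine[OF int])
  then show ?thesis by (simp add: flux late early)
qed

section \<open>The transposition identity\<close>

text \<open>The test functions of the transposition identity with names for their second derivatives.
  The factorisation \<open>(\<partial>\<^sub>t - \<partial>\<^sub>x) (\<partial>\<^sub>t + \<partial>\<^sub>x) \<phi> = 0\<close> makes \<open>\<phi>\<^sub>t + \<phi>\<^sub>x\<close> constant on the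
  characteristics \<open>t + x = const\<close>. Positivity of \<open>T\<close> makes derivatives within \<open>[0,T]\<close> unique.\<close>

locale adjoint_wave =
  fixes T :: real and \<phi> \<phi>t \<phi>x \<phi>tt \<phi>tx \<phi>xx :: "real \<Rightarrow> real \<Rightarrow> real"
  assumes T: "0 < T"
    and d\<phi>: "\<And>t x. t \<in> {0..T} \<Longrightarrow> x \<in> {0..1} \<Longrightarrow> ((\<lambda>s. \<phi> s x) has_real_derivative \<phi>t t x) (at t within {0..T})"
      "\<And>t x. t \<in> {0..T} \<Longrightarrow> x \<in> {0..1} \<Longrightarrow> ((\<lambda>r. \<phi> t r) has_real_derivative \<phi>x t x) (at x within {0..1})"
    and d\<phi>t: "\<And>t x. t \<in> {0..T} \<Longrightarrow> x \<in> {0..1} \<Longrightarrow> ((\<lambda>s. \<phi>t s x) has_real_derivative \<phi>tt t x) (at t within {0..T})"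
      "\<And>t x. t \<in> {0..T} \<Longrightarrow> x \<in> {0..1} \<Longrightarrow> ((\<lambda>r. \<phi>t t r) has_real_derivative \<phi>tx t x) (at x within {0..1})"
    and d\<phi>x: "\<And>t x. t \<in> {0..T} \<Longrightarrow> x \<in> {0..1} \<Longrightarrow> ((\<lambda>s. \<phi>x s x) has_real_derivative \<phi>tx t x) (at t within {0..T})"
      "\<And>t x. t \<in> {0..T} \<Longrightarrow> x \<in> {0..1} \<Longrightarrow> ((\<lambda>r. \<phi>x t r) has_real_derivative \<phi>xx t x) (at x within {0..1})"
    and wave: "\<And>t x. t \<in> {0..T} \<Longrightarrow> x \<in> {0..1} \<Longrightarrow> \<phi>tt t x = \<phi>xx t x"
    and cont: "continuous_on ({0..T} \<times> {0..1}) (\<lambda>p. \<phi>tt (fst p) (snd p))"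
      "continuous_on ({0..T} \<times> {0..1}) (\<lambda>p. \<phi>tx (fst p) (snd p))"
    and boundary: "\<And>t. t \<in> {0..T} \<Longrightarrow> \<phi> t 0 = 0" "\<And>t. t \<in> {0..T} \<Longrightarrow> \<phi> t 1 = 0"
begin

lemma weak_derivative: "t \<in> {0..T} \<Longrightarrow> H10_deriv (\<phi> t) (\<phi>x t)"
  and velocity_L2: "t \<in> {0..T} \<Longrightarrow> \<phi>t t \<in> L2 0 1"
proof -
  assume t: "t \<in> {0..T}"
  have cont: "continuous_on {0..1} (\<phi>x t)" "continuous_on {0..1} (\<phi>t t)"
    using DERIV_continuous_on[OF d\<phi>x(2)[OF t]] DERIV_continuous_on[OF d\<phi>t(2)[OF t]] by simp_all
  show "\<phi>t t \<in> L2 0 1" by (rule continuous_in_L2[OF cont(2)])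
  have "(LINT s|lebesgue_on {0..x}. \<phi>x t s) = \<phi> t x" if x: "x \<in> {0..1}" for x
  proof -
    have "(LINT s|lebesgue_on {0..x}. \<phi>x t s) = \<phi> t x - \<phi> t 0"
    proof (rule LINT_derivative)
      show "((\<phi> t) has_real_derivative \<phi>x t r) (at r within {0..x})" if "r \<in> {0..x}" for r
        by (rule has_field_derivative_subset[OF d\<phi>(2)[OF t]]) (use x that in auto)
      show "continuous_on {0..x} (\<phi>x t)" by (rule continuous_on_subset[OF cont(1)]) (use x in auto)
    qed (use x in auto)
    then show ?thesis using boundary(1)[OF t] by simp
  qed
  then show "H10_deriv (\<phi> t) (\<phi>x t)"
    using boundary(2)[OF t] continuous_in_L2[OF cont(1)] by (simp add: H10_deriv_def)
qed

lemma velocity_boundary: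
  assumes t: "t \<in> {0..T}"
  shows "\<phi>t t 0 = 0" "\<phi>t t 1 = 0"
proof -
  have *: "\<phi>t t x = 0" if x: "x \<in> {0..1}" and 0: "\<And>s. s \<in> {0..T} \<Longrightarrow> \<phi> s x = 0" for x
  proof -
    have "((\<lambda>s. 0 :: real) has_real_derivative \<phi>t t x) (at t within {0..T})"
      using d\<phi>(1)[OF t x] zero_less_one t 0 by (rule has_field_derivative_transform_within)
    then show ?thesis
      using vector_derivative_unique_within[of t "{0..T}" "\<lambda>_. 0" "\<phi>t t x" 0] t T
      by (auto simp: has_real_derivative_iff_has_vector_derivative trivial_limit_within islimpt_Icc)
  qed
  show "\<phi>t t 0 = 0" "\<phi>t t 1 = 0" by (rule *; simp add: boundary)+
qed

lemma flux_continuous: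
  assumes "x \<in> {0..1}" "\<tau> \<in> {0..T}"
  shows "continuous_on {0..\<tau>} (\<lambda>t. \<phi>x t x)"
proof -
  have "continuous_on {0..T} (\<lambda>t. \<phi>x t x)" using d\<phi>x(1)[OF _ assms(1)] by (rule DERIV_continuous_on)
  then show ?thesis by (rule continuous_on_subset) (use assms(2) in auto)
qed

lemma leftward_transport:
  assumes tx: "t \<in> {0..T}" "x \<in> {0..1}"
  shows "((\<lambda>p. \<phi>t (fst p) (snd p) + \<phi>x (fst p) (snd p)) has_derivative
    (\<lambda>v. (\<phi>tt t x + \<phi>tx t x) * (fst v + snd v))) (at (t, x) within {0..T} \<times> {0..1})"
proof (rule transport_has_derivative[where d = "\<lambda>t x. \<phi>tt t x + \<phi>tx t x"])
  fix t x :: real assume tx: "t \<in> {0..T}" "x \<in> {0..1}"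
  show "((\<lambda>s. \<phi>t s x + \<phi>x s x) has_real_derivative \<phi>tt t x + \<phi>tx t x) (at t within {0..T})"
    by (intro DERIV_add d\<phi>t d\<phi>x tx)
  have "((\<lambda>r. \<phi>t t r + \<phi>x t r) has_real_derivative \<phi>tx t x + \<phi>xx t x) (at x within {0..1})"
    by (intro DERIV_add d\<phi>t d\<phi>x tx)
  then show "((\<lambda>r. \<phi>t t r + \<phi>x t r) has_real_derivative \<phi>tt t x + \<phi>tx t x) (at x within {0..1})"
    by (simp only: wave[OF tx] add.commute)
qed (use cont tx in \<open>auto intro: continuous_on_add\<close>)

end

lemma adjoint_solution_imp_adjoint_wave:
  assumes "adjoint_solution T \<phi> \<phi>t \<phi>x" "0 < T"
  obtains \<phi>tt \<phi>tx \<phi>xx where "adjoint_wave T \<phi> \<phi>t \<phi>x \<phi>tt \<phi>tx \<phi>xx"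
proof -
  from assms(1) obtain \<phi>tt \<phi>tx \<phi>xx where A: "\<forall>t\<in>{0..T}. \<forall>x\<in>{0..1}.
      ((\<lambda>s. \<phi> s x) has_real_derivative \<phi>t t x) (at t within {0..T}) \<and>
      ((\<lambda>r. \<phi> t r) has_real_derivative \<phi>x t x) (at x within {0..1}) \<and>
      ((\<lambda>s. \<phi>t s x) has_real_derivative \<phi>tt t x) (at t within {0..T}) \<and>
      ((\<lambda>r. \<phi>t t r) has_real_derivative \<phi>tx t x) (at x within {0..1}) \<and>
      ((\<lambda>s. \<phi>x s x) has_real_derivative \<phi>tx t x) (at t within {0..T}) \<and>
      ((\<lambda>r. \<phi>x t r) has_real_derivative \<phi>xx t x) (at x within {0..1}) \<and>
      \<phi>tt t x - \<phi>xx t x = 0"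
    and cont: "\<forall>\<psi>\<in>{\<phi>tt, \<phi>tx, \<phi>xx}. continuous_on ({0..T} \<times> {0..1}) (\<lambda>p. \<psi> (fst p) (snd p))"
    and bd: "\<forall>t\<in>{0..T}. \<phi> t 0 = 0 \<and> \<phi> t 1 = 0"
    unfolding adjoint_solution_def by blast
  have "adjoint_wave T \<phi> \<phi>t \<phi>x \<phi>tt \<phi>tx \<phi>xx"
  proof
    show "\<phi>tt t x = \<phi>xx t x" if "t \<in> {0..T}" "x \<in> {0..1}" for t x
      using A[rule_format, OF that] by simp
  qed (use assms(2) A cont bd in blast)+
  then show ?thesis by (rule that)
qed

lemma DERIV_reflect_unit:
  assumes "x \<in> {0..1}" "(f has_real_derivative D) (at (1 - x) within {0..1})"
  shows "((\<lambda>r. f (1 - r)) has_real_derivative - D) (at x within {0..1})"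
proof -
  have "((f \<circ> (\<lambda>r. 1 - r)) has_real_derivative D * (- 1)) (at x within {0..1})"
  proof (rule DERIV_image_chain)
    have "(\<lambda>r. 1 - r) ` {0..1} = {0..1::real}" by simp
    then show "(f has_real_derivative D) (at (1 - x) within (\<lambda>r. 1 - r) ` {0..1})"
      using assms(2) by (simp only:)
  qed (auto intro!: derivative_eq_intros)
  then show ?thesis by (simp add: o_def)
qed

text \<open>This lets the right-going wave be treated as a left-going one.\<close>

lemma (in adjoint_wave) reflect:
  "adjoint_wave T (\<lambda>t x. \<phi> t (1 - x)) (\<lambda>t x. \<phi>t t (1 - x)) (\<lambda>t x. - \<phi>x t (1 - x))
    (\<lambda>t x. \<phi>tt t (1 - x)) (\<lambda>t x. - \<phi>tx t (1 - x)) (\<lambda>t x. \<phi>xx t (1 - x))"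
proof
  have cont': "continuous_on ({0..T} \<times> {0..1}) (\<lambda>p. \<psi> (fst p) (1 - snd p))"
    if "continuous_on ({0..T} \<times> {0..1}) (\<lambda>p. \<psi> (fst p) (snd p))" for \<psi> :: "real \<Rightarrow> real \<Rightarrow> real"
  proof -
    from that have "continuous_on ({0..T} \<times> {0..1})
        (\<lambda>p. \<psi> (fst (fst p, 1 - snd p)) (snd (fst p, 1 - snd p)))"
      by (rule continuous_on_compose2) (auto intro!: continuous_intros)
    then show ?thesis by simp
  qed
  show "continuous_on ({0..T} \<times> {0..1}) (\<lambda>p. \<phi>tt (fst p) (1 - snd p))"
    using cont(1) by (rule cont')
  show "continuous_on ({0..T} \<times> {0..1}) (\<lambda>p. - \<phi>tx (fst p) (1 - snd p))"
    using cont(2) by (intro continuous_on_minus cont')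
next
  fix t x :: real assume t: "t \<in> {0..T}" and x: "x \<in> {0..1}"
  then have x': "1 - x \<in> {0..1}" by auto
  show "((\<lambda>s. \<phi> s (1 - x)) has_real_derivative \<phi>t t (1 - x)) (at t within {0..T})"
    "((\<lambda>s. \<phi>t s (1 - x)) has_real_derivative \<phi>tt t (1 - x)) (at t within {0..T})"
    "\<phi>tt t (1 - x) = \<phi>xx t (1 - x)"
    using d\<phi>(1) d\<phi>t(1) wave t x' by simp_all
  show "((\<lambda>s. - \<phi>x s (1 - x)) has_real_derivative - \<phi>tx t (1 - x)) (at t within {0..T})"
    by (intro DERIV_minus d\<phi>x t x')
  show "((\<lambda>r. \<phi> t (1 - r)) has_real_derivative - \<phi>x t (1 - x)) (at x within {0..1})"
    "((\<lambda>r. \<phi>t t (1 - r)) has_real_derivative - \<phi>tx t (1 - x)) (at x within {0..1})"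
    by (rule DERIV_reflect_unit[OF x], rule d\<phi> d\<phi>t, fact t, fact x')+
  have "((\<lambda>r. - \<phi>x t (1 - r)) has_real_derivative - (- \<phi>xx t (1 - x))) (at x within {0..1})"
    by (intro DERIV_minus DERIV_reflect_unit[OF x] d\<phi>x t x')
  then show "((\<lambda>r. - \<phi>x t (1 - r)) has_real_derivative \<phi>xx t (1 - x)) (at x within {0..1})"
    by simp
qed (use T boundary in simp_all)

text \<open>Paired with the test function, the left-going wave meets \<open>\<phi>\<^sub>t + \<phi>\<^sub>x\<close> and the reflected
  right-going wave meets the same expression for the reflected test function. The conservation law
  for each of the two gives a boundary flux; as \<open>\<phi>\<^sub>t = 0\<close> on the boundary, the sum of the fluxes
  contains only \<open>\<phi>\<^sub>x\<close>, weighted by the boundary values of the d'Alembert solution.\<close>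

lemma (in adjoint_wave) dalembert_balance:
  assumes \<tau>: "\<tau> \<in> {0..T}"
    and Q: "profile Q" and P: "profile P"
  shows "dalembert_velocity Q P \<tau> (\<phi> \<tau>) - (LINT x|lebesgue_on {0..1}. dalembert Q P \<tau> x * \<phi>t \<tau> x) =
    dalembert_velocity Q P 0 (\<phi> 0) - (LINT x|lebesgue_on {0..1}. dalembert Q P 0 x * \<phi>t 0 x) +
    (LINT t|lebesgue_on {0..\<tau>}. (Q t + P (t + 1)) * \<phi>x t 0 - (Q (t + 1) + P t) * \<phi>x t 1)"
proof -
  let ?M = "lebesgue_on {0..1::real}"
  let ?w = "\<lambda>t x. \<phi>t t x + \<phi>x t x" and ?w' = "\<lambda>t x. \<phi>t t (1 - x) + - \<phi>x t (1 - x)"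
  interpret r: adjoint_wave T "\<lambda>t x. \<phi> t (1 - x)" "\<lambda>t x. \<phi>t t (1 - x)" "\<lambda>t x. - \<phi>x t (1 - x)"
    "\<lambda>t x. \<phi>tt t (1 - x)" "\<lambda>t x. - \<phi>tx t (1 - x)" "\<lambda>t x. \<phi>xx t (1 - x)"
    by (rule reflect)
  have rep: "dalembert_velocity Q P t (\<phi> t) - (LINT x|?M. dalembert Q P t x * \<phi>t t x) =
      - (LINT x|?M. Q (t + x) * ?w t x) - (LINT x|?M. P (t + x) * ?w' t x)" if t: "t \<in> {0..T}" for t
  proof -
    note H = weak_derivative[OF t] velocity_L2[OF t] r.weak_derivative[OF t] r.velocity_L2[OF t]
    have gx: "\<phi>x t \<in> L2 0 1" using H(1) by (rule H10_deriv_L2)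
    have gx': "(\<lambda>x. - \<phi>x t (1 - x)) \<in> L2 0 1" using H(3) by (rule H10_deriv_L2)
    have int: "integrable ?M (\<lambda>x. Q (t + x) * \<phi>t t x)" "integrable ?M (\<lambda>x. Q (t + x) * \<phi>x t x)"
      "integrable ?M (\<lambda>x. P (t + x) * \<phi>t t (1 - x))" "integrable ?M (\<lambda>x. P (t + x) * - \<phi>x t (1 - x))"
      by (intro L2_mult_integrable profile_L2 Q P H gx gx')+
    have "(LINT x|?M. Q (t + x) * ?w t x) = (LINT x|?M. Q (t + x) * \<phi>t t x) + (LINT x|?M. Q (t + x) * \<phi>x t x)"
      using int by (simp add: distrib_left)
    moreover have "(LINT x|?M. P (t + x) * ?w' t x) =
        (LINT x|?M. P (t + x) * \<phi>t t (1 - x)) + (LINT x|?M. P (t + x) * - \<phi>x t (1 - x))"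
      unfolding distrib_left using int(3,4) by (rule Bochner_Integration.integral_add)
    ultimately show ?thesis
      using dalembert_pairing[OF Q P H(2), of t] dalembert_pairing[OF Q profile_uminus[OF P] gx, of t] t
        dalembert_velocity_eq[OF Q P H(1), of t] by simp
  qed
  have flux: "(LINT t|lebesgue_on {0..\<tau>}. Q (t + 1) * ?w t 1 - Q t * ?w t 0) +
      (LINT t|lebesgue_on {0..\<tau>}. P (t + 1) * ?w' t 1 - P t * ?w' t 0) =
      - (LINT t|lebesgue_on {0..\<tau>}. (Q t + P (t + 1)) * \<phi>x t 0 - (Q (t + 1) + P t) * \<phi>x t 1)"
  proof -
    have int: "integrable (lebesgue_on {0..\<tau>}) (\<lambda>t. R (c + t) * \<phi>x t x)"
      if "profile R" "x \<in> {0..1}" for R c x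
      using that by (intro L2_mult_integrable profile_L2 continuous_in_L2 flux_continuous[OF _ \<tau>])
    note i = int[OF Q, of _ 0] int[OF Q, of _ 1] int[OF P, of _ 0] int[OF P, of _ 1]
    have "(LINT t|lebesgue_on {0..\<tau>}. Q (t + 1) * ?w t 1 - Q t * ?w t 0) =
        (LINT t|lebesgue_on {0..\<tau>}. Q (1 + t) * \<phi>x t 1 - Q (0 + t) * \<phi>x t 0)"
      using \<tau> T by (intro Bochner_Integration.integral_cong)
        (auto simp: velocity_boundary r.velocity_boundary add.commute)
    moreover have "(LINT t|lebesgue_on {0..\<tau>}. P (t + 1) * ?w' t 1 - P t * ?w' t 0) =
        (LINT t|lebesgue_on {0..\<tau>}. P (0 + t) * \<phi>x t 1 - P (1 + t) * \<phi>x t 0)"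
      using \<tau> T by (intro Bochner_Integration.integral_cong)
        (auto simp: velocity_boundary r.velocity_boundary add.commute)
    moreover have "(LINT t|lebesgue_on {0..\<tau>}. (Q t + P (t + 1)) * \<phi>x t 0 - (Q (t + 1) + P t) * \<phi>x t 1) =
        (LINT t|lebesgue_on {0..\<tau>}. (Q (0 + t) * \<phi>x t 0 - Q (1 + t) * \<phi>x t 1) +
           (P (1 + t) * \<phi>x t 0 - P (0 + t) * \<phi>x t 1))"
      by (intro Bochner_Integration.integral_cong) (simp_all add: algebra_simps)
    ultimately show ?thesis using i by simp
  qed
  have "(LINT x|?M. Q (\<tau> + x) * ?w \<tau> x) = (LINT x|?M. Q (0 + x) * ?w 0 x) +
      (LINT t|lebesgue_on {0..\<tau>}. Q (t + 1) * ?w t 1 - Q t * ?w t 0)"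
    using transport_balance[OF Q \<tau> leftward_transport] by simp
  moreover have "(LINT x|?M. P (\<tau> + x) * ?w' \<tau> x) = (LINT x|?M. P (0 + x) * ?w' 0 x) +
      (LINT t|lebesgue_on {0..\<tau>}. P (t + 1) * ?w' t 1 - P t * ?w' t 0)"
    using transport_balance[OF P \<tau> r.leftward_transport] by simp
  ultimately show ?thesis
    using rep[OF \<tau>] rep[of 0] T flux by simp
qed

text \<open>The state at time \<open>t\<close> is the rest state \<open>a\<close> as soon as sum and difference of the two profiles
  are constant on the interval, the sum being \<open>a\<close>; the controls are the boundary values.
  Everything is required on open intervals only, so that the profiles may jump at their ends.\<close>

lemma dalembert_drives:
  assumes T: "0 < T" and Q: "profile Q" and P: "profile P"
    and u: "u0 \<in> L2 0 T" "u1 \<in> L2 0 T"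
    and u0: "\<And>t. t \<in> {0<..<T} \<Longrightarrow> u0 t = Q t + P (t + 1)"
    and u1: "\<And>t. t \<in> {0<..<T} \<Longrightarrow> u1 t = Q (t + 1) + P t"
    and start: "\<And>x. x \<in> {0<..<1} \<Longrightarrow> Q x + P (1 - x) = a"
      "\<And>x. x \<in> {0<..<1} \<Longrightarrow> Q x - P (1 - x) = c"
    and final: "\<And>x. x \<in> {0<..<1} \<Longrightarrow> Q (T + x) + P (T + 1 - x) = b"
      "\<And>x. x \<in> {0<..<1} \<Longrightarrow> Q (T + x) - P (T + 1 - x) = c'"
  shows "drives T (\<lambda>_. a) (\<lambda>_. b) u0 u1 (dalembert Q P) (dalembert_velocity Q P)"
  unfolding drives_def wave_solution_def
proof (intro conjI ballI allI impI)
  show "(\<lambda>_. 0) \<in> Hm1" by (auto simp: Hm1_def Hm1_bound_def intro: exI[of _ 0])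
  show "(\<lambda>p. dalembert Q P (fst p) (snd p)) \<in> borel_measurable (lebesgue_on ({0..T} \<times> {0..1}))"
    by (rule dalembert_measurable[OF Q P])
  show "L2_continuous T (dalembert Q P)"
    unfolding L2_continuous_def using dalembert_L2[OF Q P] dalembert_L2_continuous[OF Q P] by blast
  show "Hm1_continuous T (dalembert_velocity Q P)" by (rule dalembert_velocity_continuous[OF Q P])
  show "AE x in lebesgue_on {0..1}. dalembert Q P 0 x = a"
    using AE_interior by eventually_elim (simp add: dalembert_def start(1))
  show "AE x in lebesgue_on {0..1}. dalembert Q P T x = b"
    using AE_interior by eventually_elim (simp add: dalembert_def final(1))
  show rest: "dalembert_velocity Q P 0 \<psi> = 0" if "\<psi> \<in> H10" for \<psi>
    by (rule dalembert_velocity_zero[OF Q P _ _ that, of 0 c]) (auto simp: start(2))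
  show "dalembert_velocity Q P T \<psi> = 0" if "\<psi> \<in> H10" for \<psi>
    by (rule dalembert_velocity_zero[OF Q P _ _ that, of T c']) (use T final(2) in auto)
  show "((\<lambda>s. LINT x|lebesgue_on {0..1}. dalembert Q P s x * \<psi> x) has_real_derivative
      dalembert_velocity Q P t \<psi>) (at t within {0..T})" if "\<psi> \<in> H10" "t \<in> {0..T}" for \<psi> t
  proof -
    obtain g where g: "H10_deriv \<psi> g" using \<open>\<psi> \<in> H10\<close> by (auto simp: H10_def)
    show ?thesis using dalembert_pairing_derivative[OF Q P g that(2)] that(2)
      by (simp add: dalembert_velocity_eq[OF Q P g])
  qed
  fix \<phi> \<phi>t \<phi>x \<tau> assume adj: "adjoint_solution T \<phi> \<phi>t \<phi>x" and \<tau>: "\<tau> \<in> {0..T}"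
  obtain \<phi>tt \<phi>tx \<phi>xx where "adjoint_wave T \<phi> \<phi>t \<phi>x \<phi>tt \<phi>tx \<phi>xx"
    using adjoint_solution_imp_adjoint_wave[OF adj T] .
  then interpret adjoint_wave T \<phi> \<phi>t \<phi>x \<phi>tt \<phi>tx \<phi>xx .
  have 0: "0 \<in> {0..T}" using T by simp
  have "\<phi> 0 \<in> H10" using weak_derivative[OF 0] by (auto simp: H10_def)
  have meas: "(\<lambda>t. \<phi>x t x) \<in> borel_measurable (lebesgue_on {0..\<tau>})" if "x \<in> {0..1}" for x
    using flux_continuous[OF that \<tau>]
    by (intro continuous_imp_measurable_on_sets_lebesgue) auto
  have um: "v \<in> borel_measurable (lebesgue_on {0..\<tau>})" if "v \<in> L2 0 T" for v
    using integrable_subinterval[OF L2_integrable[OF that], of 0 \<tau>] \<tau> by auto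
  have Qm: "(\<lambda>t. R (c + t)) \<in> borel_measurable (lebesgue_on {0..\<tau>})" if "profile R" for R c
    by (rule profile_measurable(1)[OF that])
  have "(LINT t|lebesgue_on {0..\<tau>}. (Q t + P (t + 1)) * \<phi>x t 0 - (Q (t + 1) + P t) * \<phi>x t 1) =
      (LINT t|lebesgue_on {0..\<tau>}. u0 t * \<phi>x t 0 - u1 t * \<phi>x t 1)"
  proof (rule integral_cong_AE)
    show "AE t in lebesgue_on {0..\<tau>}. (Q t + P (t + 1)) * \<phi>x t 0 - (Q (t + 1) + P t) * \<phi>x t 1 =
        u0 t * \<phi>x t 0 - u1 t * \<phi>x t 1"
      using AE_interior by eventually_elim (use \<tau> u0 u1 in simp)
    show "(\<lambda>t. (Q t + P (t + 1)) * \<phi>x t 0 - (Q (t + 1) + P t) * \<phi>x t 1) \<in> borel_measurable (lebesgue_on {0..\<tau>})"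
      using Qm[OF Q, of 0] Qm[OF Q, of 1] Qm[OF P, of 0] Qm[OF P, of 1] meas
      by (intro borel_measurable_diff borel_measurable_times borel_measurable_add) (simp_all add: add.commute)
    show "(\<lambda>t. u0 t * \<phi>x t 0 - u1 t * \<phi>x t 1) \<in> borel_measurable (lebesgue_on {0..\<tau>})"
      using um u meas by (intro borel_measurable_diff borel_measurable_times) auto
  qed
  moreover have "(LINT x|lebesgue_on {0..1}. dalembert Q P 0 x * \<phi>t 0 x) = (LINT x|lebesgue_on {0..1}. a * \<phi>t 0 x)"
  proof (rule integral_cong_AE)
    show "AE x in lebesgue_on {0..1}. dalembert Q P 0 x * \<phi>t 0 x = a * \<phi>t 0 x"
      using AE_interior by eventually_elim (simp add: dalembert_def start(1))
  qed (use velocity_L2[OF 0] integrable_dalembert_mult[OF Q P velocity_L2[OF 0], of 0]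
      in \<open>auto simp: L2_def\<close>)
  ultimately show "dalembert_velocity Q P \<tau> (\<phi> \<tau>) - (LINT x|lebesgue_on {0..1}. dalembert Q P \<tau> x * \<phi>t \<tau> x) =
      0 - (LINT x|lebesgue_on {0..1}. a * \<phi>t 0 x) +
      (LINT t|lebesgue_on {0..\<tau>}. u0 t * \<phi>x t 0 - u1 t * \<phi>x t 1)"
    using dalembert_balance[OF \<tau> Q P] rest[OF \<open>\<phi> 0 \<in> H10\<close>] by simp
qed (use T u const_in_L2 in auto)

section \<open>A lower bound for the control time\<close>

text \<open>At the knot the difference quotient of a truncated power is the truncated power of one degree less.\<close>

lemma DERIV_truncated_power:
  fixes k s :: real
  shows "((\<lambda>s. (max 0 (s - k)) ^ Suc (Suc n)) has_real_derivative
          real (Suc (Suc n)) * (max 0 (s - k)) ^ Suc n) (at s)"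
proof (cases s k rule: linorder_cases)
  case less
  have "((\<lambda>s. (max 0 (s - k)) ^ Suc (Suc n)) has_real_derivative 0) (at s)"
  proof (rule has_field_derivative_transform_within)
    show "((\<lambda>_. 0 :: real) has_real_derivative 0) (at s)" by simp
    show "0 < k - s" using less by simp
    show "0 = (max 0 (r - k)) ^ Suc (Suc n)" if "dist r s < k - s" for r
    proof -
      have "r - k \<le> 0" using that by (simp add: dist_real_def)
      then show ?thesis by (simp add: max_absorb1)
    qed
  qed simp
  then show ?thesis using less by (simp add: max_def)
next
  case greater
  have "((\<lambda>s. (max 0 (s - k)) ^ Suc (Suc n)) has_real_derivative
      real (Suc (Suc n)) * (s - k) ^ Suc n) (at s)"
  proof (rule has_field_derivative_transform_within)
    have "((\<lambda>s. s - k) has_real_derivative 1) (at s)" by (auto intro!: derivative_eq_intros)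
    from DERIV_power[OF this, of "Suc (Suc n)"]
    show "((\<lambda>s. (s - k) ^ Suc (Suc n)) has_real_derivative real (Suc (Suc n)) * (s - k) ^ Suc n) (at s)"
      by simp
    show "0 < s - k" using greater by simp
    show "(r - k) ^ Suc (Suc n) = (max 0 (r - k)) ^ Suc (Suc n)" if "dist r s < s - k" for r
      using that by (simp add: dist_real_def max_def)
  qed simp
  then show ?thesis using greater by (simp add: max_def)
next
  case equal
  have "((\<lambda>h. (max 0 h) ^ Suc n) \<longlongrightarrow> (max 0 0) ^ Suc n) (at (0::real))"
    by (intro tendsto_intros)
  then have "((\<lambda>h. (max 0 h) ^ Suc n) \<longlongrightarrow> 0) (at (0::real))" by simp
  also have "?this \<longleftrightarrow>
      ((\<lambda>h. ((max 0 (s + h - k)) ^ Suc (Suc n) - (max 0 (s - k)) ^ Suc (Suc n)) / h) \<longlongrightarrow> 0) (at 0)"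
    by (rule LIM_equal) (simp add: equal max_def)
  finally have "((\<lambda>h. ((max 0 (s + h - k)) ^ Suc (Suc n) - (max 0 (s - k)) ^ Suc (Suc n)) / h) \<longlongrightarrow> 0) (at 0)" .
  then show ?thesis using equal by (simp add: DERIV_def)
qed

text \<open>A cubic spline with knots at \<open>T\<close>, \<open>T + d\<close>, \<open>T + 2 d\<close> and \<open>T + 3 d = 1\<close>: the third
  difference of the truncated cube. Beyond the last knot it equals the third difference of the
  polynomial \<open>s\<^sup>3\<close>, which is the constant \<open>6 d\<^sup>3\<close>.\<close>

lemma smooth_step:
  fixes T :: real
  assumes "T < 1"
  obtains e h h1 h2 where "0 < (e :: real)"
    "\<And>s. (h has_real_derivative h1 s) (at s)" "\<And>s. (h1 has_real_derivative h2 s) (at s)"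
    "continuous_on UNIV h2"
    "\<And>s. s \<le> T \<Longrightarrow> h s = 0" "\<And>s. s \<le> T \<Longrightarrow> h1 s = 0"
    "\<And>s. 1 \<le> s \<Longrightarrow> h s = e" "\<And>s. 1 \<le> s \<Longrightarrow> h1 s = 0"
proof -
  define d where "d = (1 - T) / 3"
  have d: "0 < d" "T + 3 * d = 1" using assms by (simp_all add: d_def field_simps)
  define p where "p n j s = (max 0 (s - (T + j * d))) ^ n" for n and j s :: real
  define third where "third n s = p n 0 s - 3 * p n 1 s + 3 * p n 2 s - p n 3 s" for n s
  have dp: "(p (Suc (Suc n)) j has_real_derivative real (Suc (Suc n)) * p (Suc n) j s) (at s)" for n j s
    unfolding p_def[abs_def] by (rule DERIV_truncated_power)
  have d3: "(third (Suc (Suc n)) has_real_derivative real (Suc (Suc n)) * third (Suc n) s) (at s)" for n s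
  proof -
    have "(third (Suc (Suc n)) has_real_derivative
        real (Suc (Suc n)) * p (Suc n) 0 s - 3 * (real (Suc (Suc n)) * p (Suc n) 1 s)
        + 3 * (real (Suc (Suc n)) * p (Suc n) 2 s) - real (Suc (Suc n)) * p (Suc n) 3 s) (at s)"
      unfolding third_def[abs_def] by (intro DERIV_add DERIV_diff DERIV_cmult dp)
    then show ?thesis by (simp add: third_def algebra_simps del: of_nat_Suc)
  qed
  have low: "third (Suc n) s = 0" if "s \<le> T" for n s
    using that d(1) by (simp add: third_def p_def max_def)
  have high: "third n s = (s - T) ^ n - 3 * (s - T - d) ^ n + 3 * (s - T - 2 * d) ^ n - (s - T - 3 * d) ^ n"
    if "1 \<le> s" for n s
    using that d by (simp add: third_def p_def max_def diff_diff_eq)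
  show ?thesis
  proof (rule that[of "6 * d ^ 3" "third 3" "\<lambda>s. 3 * third 2 s" "\<lambda>s. 6 * third 1 s"])
    show "0 < 6 * d ^ 3" using d by simp
    show "(third 3 has_real_derivative 3 * third 2 s) (at s)" for s
      using d3[of 1 s] by (simp add: numeral_eq_Suc)
    show "((\<lambda>s. 3 * third 2 s) has_real_derivative 6 * third 1 s) (at s)" for s
      using DERIV_cmult[OF d3[of 0 s], of 3] by (simp add: numeral_eq_Suc)
    show "continuous_on UNIV (\<lambda>s. 6 * third 1 s)"
      unfolding third_def p_def by (intro continuous_intros)
    show "third 3 s = 0" "3 * third 2 s = 0" if "s \<le> T" for s
      using low[OF that, of 2] low[OF that, of 1] by (simp_all add: numeral_eq_Suc)
    show "third 3 s = 6 * d ^ 3" if "1 \<le> s" for s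
      unfolding high[OF that] by (simp add: power3_eq_cube algebra_simps)
    show "3 * third 2 s = 0" if "1 \<le> s" for s
      unfolding high[OF that] by (simp add: power2_eq_square algebra_simps)
  qed
qed

text \<open>For \<open>T < 1\<close> the transposition identity is tested with \<open>\<phi>(t,x) = h(x + t) - h(x - t + T)\<close>, where
  \<open>h\<close> passes from 0 to \<open>e\<close> within \<open>[T,1]\<close>. On the boundary \<open>\<phi>\<close> and \<open>\<phi>\<^sub>x\<close> vanish up to time
  \<open>T\<close>, so the controls drop out of the identity. What remains of it is
  \<open>b \<integral>\<phi>\<^sub>t(T,x) dx = a \<integral>\<phi>\<^sub>t(0,x) dx\<close>, and both integrals equal \<open>2 e\<close>. The minus sign is
  essential: each of the two travelling waves taken separately does not vanish at both ends.\<close>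

lemma reaching_different_rest_state_takes_time_1:
  assumes drv: "drives T (\<lambda>_. a) (\<lambda>_. b) u0 u1 y z" and "T < 1"
  shows "a = b"
proof -
  have T: "0 < T" and yT: "AE x in lebesgue_on {0..1}. y T x = b" and zT: "\<forall>\<psi>\<in>H10. z T \<psi> = 0"
    and yL2: "y T \<in> L2 0 1"
    using drv by (auto simp: drives_def wave_solution_def L2_continuous_def)
  obtain e h h1 h2 where e: "0 < e" and dh: "\<And>s. (h has_real_derivative h1 s) (at s)"
    and dh1: "\<And>s. (h1 has_real_derivative h2 s) (at s)" and ch2: "continuous_on UNIV h2"
    and low: "\<And>s. s \<le> T \<Longrightarrow> h s = 0" "\<And>s. s \<le> T \<Longrightarrow> h1 s = 0"
    and high: "\<And>s. 1 \<le> s \<Longrightarrow> h s = e" "\<And>s. 1 \<le> s \<Longrightarrow> h1 s = 0"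
    by (rule smooth_step[OF \<open>T < 1\<close>]) (rule that)
  have ch1: "continuous_on UNIV h1" using dh1 by (intro DERIV_continuous_on) (auto intro: has_field_derivative_at_within)
  define \<phi> where "\<phi> t x = h (x + t) - h (x - t + T)" for t x
  define \<phi>t where "\<phi>t t x = h1 (x + t) + h1 (x - t + T)" for t x
  define \<phi>x where "\<phi>x t x = h1 (x + t) - h1 (x - t + T)" for t x
  have chain: "((\<lambda>s. f (c * s + k)) has_real_derivative c * f' (c * s + k)) (at s within S)"
    if "\<And>s. (f has_real_derivative f' s) (at s)" for f f' :: "real \<Rightarrow> real" and c k s S
  proof -
    have "((\<lambda>s. f (c * s + k)) has_real_derivative f' (c * s + k) * c) (at s within S)"
      by (rule DERIV_chain2[OF that]) (auto intro!: derivative_eq_intros)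
    then show ?thesis by (simp add: mult.commute)
  qed
  have space: "((\<lambda>r. f (r + t)) has_real_derivative f' (x + t)) (at x within S)"
    "((\<lambda>r. f (r - t + T)) has_real_derivative f' (x - t + T)) (at x within S)"
    and time: "((\<lambda>s. f (x + s)) has_real_derivative f' (x + t)) (at t within S)"
    "((\<lambda>s. f (x - s + T)) has_real_derivative - f' (x - t + T)) (at t within S)"
    if "\<And>s. (f has_real_derivative f' s) (at s)" for f f' :: "real \<Rightarrow> real" and t x S
    using chain[OF that, of 1 t x S] chain[OF that, of 1 "T - t" x S]
      chain[OF that, of 1 x t S] chain[OF that, of "- 1" "x + T" t S]
    by (simp_all add: algebra_simps)
  have comp: "continuous_on S (\<lambda>p. h2 (q p))" if "continuous_on S q" for S :: "(real \<times> real) set" and q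
    using ch2 that by (rule continuous_on_compose2) auto
  have W: "adjoint_wave T \<phi> \<phi>t \<phi>x (\<lambda>t x. h2 (x + t) - h2 (x - t + T))
      (\<lambda>t x. h2 (x + t) + h2 (x - t + T)) (\<lambda>t x. h2 (x + t) - h2 (x - t + T))"
  proof
    fix t x :: real
    show "((\<lambda>s. \<phi> s x) has_real_derivative \<phi>t t x) (at t within {0..T})"
      using DERIV_diff[OF time[OF dh]] by (simp add: \<phi>_def \<phi>t_def)
    show "((\<lambda>r. \<phi> t r) has_real_derivative \<phi>x t x) (at x within {0..1})"
      using DERIV_diff[OF space[OF dh]] by (simp add: \<phi>_def \<phi>x_def)
    show "((\<lambda>s. \<phi>t s x) has_real_derivative h2 (x + t) - h2 (x - t + T)) (at t within {0..T})"
      using DERIV_add[OF time[OF dh1]] by (simp add: \<phi>t_def)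
    show "((\<lambda>r. \<phi>t t r) has_real_derivative h2 (x + t) + h2 (x - t + T)) (at x within {0..1})"
      using DERIV_add[OF space[OF dh1]] by (simp add: \<phi>t_def)
    show "((\<lambda>s. \<phi>x s x) has_real_derivative h2 (x + t) + h2 (x - t + T)) (at t within {0..T})"
      using DERIV_diff[OF time[OF dh1]] by (simp add: \<phi>x_def)
    show "((\<lambda>r. \<phi>x t r) has_real_derivative h2 (x + t) - h2 (x - t + T)) (at x within {0..1})"
      using DERIV_diff[OF space[OF dh1]] by (simp add: \<phi>x_def)
  next
    show "continuous_on ({0..T} \<times> {0..1}) (\<lambda>p. h2 (snd p + fst p) - h2 (snd p - fst p + T))"
      "continuous_on ({0..T} \<times> {0..1}) (\<lambda>p. h2 (snd p + fst p) + h2 (snd p - fst p + T))"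
      by (intro continuous_intros comp)+
    fix t assume "t \<in> {0..T}"
    then show "\<phi> t 0 = 0" "\<phi> t 1 = 0" by (auto simp: \<phi>_def low high)
  qed (rule T refl)+
  then interpret adjoint_wave T \<phi> \<phi>t \<phi>x "\<lambda>t x. h2 (x + t) - h2 (x - t + T)"
    "\<lambda>t x. h2 (x + t) + h2 (x - t + T)" "\<lambda>t x. h2 (x + t) - h2 (x - t + T)" .
  have mass: "(LINT x|lebesgue_on {0..1}. \<phi>t t x) = 2 * e" if t: "t \<in> {0, T}" for t
  proof -
    have "(LINT x|lebesgue_on {0..1}. \<phi>t t x) = (h (1 + t) + h (1 - t + T)) - (h (0 + t) + h (0 - t + T))"
    proof (rule LINT_derivative)
      show "((\<lambda>x. h (x + t) + h (x - t + T)) has_real_derivative \<phi>t t x) (at x within {0..1})" for x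
        unfolding \<phi>t_def by (rule DERIV_add[OF space[OF dh]])
      show "continuous_on {0..1} (\<phi>t t)"
        unfolding \<phi>t_def[abs_def] by (intro continuous_intros continuous_on_compose2[OF ch1]) auto
    qed simp
    then show ?thesis using t T \<open>T < 1\<close> by (auto simp: low high)
  qed
  have adj: "adjoint_solution T \<phi> \<phi>t \<phi>x"
    unfolding adjoint_solution_def
  proof (rule exI, rule exI, rule exI, intro conjI)
    show "\<forall>t\<in>{0..T}. \<forall>x\<in>{0..1}.
      ((\<lambda>s. \<phi> s x) has_real_derivative \<phi>t t x) (at t within {0..T}) \<and>
      ((\<lambda>r. \<phi> t r) has_real_derivative \<phi>x t x) (at x within {0..1}) \<and>
      ((\<lambda>s. \<phi>t s x) has_real_derivative h2 (x + t) - h2 (x - t + T)) (at t within {0..T}) \<and>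
      ((\<lambda>r. \<phi>t t r) has_real_derivative h2 (x + t) + h2 (x - t + T)) (at x within {0..1}) \<and>
      ((\<lambda>s. \<phi>x s x) has_real_derivative h2 (x + t) + h2 (x - t + T)) (at t within {0..T}) \<and>
      ((\<lambda>r. \<phi>x t r) has_real_derivative h2 (x + t) - h2 (x - t + T)) (at x within {0..1}) \<and>
      (h2 (x + t) - h2 (x - t + T)) - (h2 (x + t) - h2 (x - t + T)) = 0"
      by (intro ballI conjI d\<phi> d\<phi>t d\<phi>x diff_self; assumption)
    show "\<forall>\<psi>\<in>{\<lambda>t x. h2 (x + t) - h2 (x - t + T), \<lambda>t x. h2 (x + t) + h2 (x - t + T),
        \<lambda>t x. h2 (x + t) - h2 (x - t + T)}. continuous_on ({0..T} \<times> {0..1}) (\<lambda>p. \<psi> (fst p) (snd p))"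
      using cont by simp
    show "\<forall>t\<in>{0..T}. \<phi> t 0 = 0 \<and> \<phi> t 1 = 0" by (intro ballI conjI boundary)
  qed
  have "T \<in> {0..T}" "0 \<in> {0..T}" using T by auto
  have flux: "\<phi>x t 0 = 0" "\<phi>x t 1 = 0" if "t \<in> {0..T}" for t
    using that by (auto simp: \<phi>x_def low high)
  have "z T (\<phi> T) - (LINT x|lebesgue_on {0..1}. y T x * \<phi>t T x) =
      0 - (LINT x|lebesgue_on {0..1}. a * \<phi>t 0 x) +
      (LINT t|lebesgue_on {0..T}. u0 t * \<phi>x t 0 - u1 t * \<phi>x t 1)"
    using drv adj \<open>T \<in> {0..T}\<close> unfolding drives_def wave_solution_def by blast
  moreover have "(LINT t|lebesgue_on {0..T}. u0 t * \<phi>x t 0 - u1 t * \<phi>x t 1) = 0"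
    by (rule integral_eq_zero_AE) (auto simp: flux)
  moreover have "z T (\<phi> T) = 0" using zT weak_derivative[OF \<open>T \<in> {0..T}\<close>] by (auto simp: H10_def)
  moreover have "(LINT x|lebesgue_on {0..1}. y T x * \<phi>t T x) = (LINT x|lebesgue_on {0..1}. b * \<phi>t T x)"
  proof (rule integral_cong_AE)
    show "AE x in lebesgue_on {0..1}. y T x * \<phi>t T x = b * \<phi>t T x" using yT by eventually_elim simp
  qed (use yL2 velocity_L2[OF \<open>T \<in> {0..T}\<close>] in \<open>auto simp: L2_def\<close>)
  ultimately show "a = b" using e by (simp add: mass)
qed

section \<open>Explicit controls and minimal times\<close>

text \<open>The left-going step from \<open>y0\<close> to \<open>y1\<close> that enters at \<open>x = 1\<close> at time 0 has swept the
  whole interval by time 1, and so has its reflection. A convex combination of the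
  two solutions has the same initial and final states.\<close>

lemma step_drives:
  fixes y0 y1 l :: real
  assumes y: "0 \<le> y0" "0 \<le> y1" and l: "l \<in> {0..1}"
  shows "\<exists>y z. drives 1 (\<lambda>_. y0) (\<lambda>_. y1) (\<lambda>_. (1 - l) * y0 + l * y1) (\<lambda>_. (1 - l) * y1 + l * y0) y z
    \<and> nonneg_state 1 y"
proof (intro exI conjI)
  let ?S = "\<lambda>s. if s < 1 then y0 else y1"
  let ?Q = "\<lambda>s. (1 - l) * ?S s" and ?P = "\<lambda>s. l * ?S s"
  have QP: "profile ?Q" "profile ?P" by (intro profile_scale step_profile)+
  show "drives 1 (\<lambda>_. y0) (\<lambda>_. y1) (\<lambda>_. (1 - l) * y0 + l * y1) (\<lambda>_. (1 - l) * y1 + l * y0)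
      (dalembert ?Q ?P) (dalembert_velocity ?Q ?P)"
  proof (rule dalembert_drives[OF zero_less_one QP const_in_L2 const_in_L2])
    fix x :: real assume x: "x \<in> {0<..<1}"
    then show "?Q x - ?P (1 - x) = (1 - 2 * l) * y0" "?Q (1 + x) - ?P (1 + 1 - x) = (1 - 2 * l) * y1"
      "?Q x + ?P (1 - x) = y0" "?Q (1 + x) + ?P (1 + 1 - x) = y1"
      by (simp_all add: left_diff_distrib)
  qed auto
  have "0 \<le> dalembert ?Q ?P t x" for t x
    using y l by (simp add: dalembert_def)
  then show "nonneg_state 1 (dalembert ?Q ?P)" by (simp add: nonneg_state_def)
qed

text \<open>The solution is a single left-going wave \<open>Q (t + x)\<close>, where \<open>Q\<close> interpolates linearly between
  \<open>y0\<close> on \<open>(-\<infinity>,1]\<close> and \<open>y1\<close> on \<open>[T,\<infinity>)\<close>; the two controls are its values at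
  \<open>x = 0\<close> and \<open>x = 1\<close>.\<close>

lemma ramp_drives:
  fixes y0 y1 T :: real
  defines "u0 \<equiv> \<lambda>t. if t \<le> 1 then y0 else (y1 - y0) * ((t - 1) / (T - 1)) + y0"
    and "u1 \<equiv> \<lambda>t. if t < T - 1 then (y1 - y0) * (t / (T - 1)) + y0 else y1"
  assumes y: "0 \<le> y0" "0 \<le> y1" and T: "1 < T"
  shows "u0 \<in> L2_nonneg 0 T" "u1 \<in> L2_nonneg 0 T" "\<forall>t\<in>{0..T}. 0 \<le> u0 t \<and> 0 \<le> u1 t"
    "\<exists>y z. drives T (\<lambda>_. y0) (\<lambda>_. y1) u0 u1 y z \<and>
       continuous_on ({0..T} \<times> {0..1}) (\<lambda>p. y (fst p) (snd p)) \<and>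
       (\<forall>t\<in>{0..T}. \<forall>x\<in>{0..1}. 0 \<le> y t x)"
proof -
  define \<theta> where "\<theta> s = max 0 (min 1 ((s - 1) / (T - 1)))" for s
  define Q where "Q s = (1 - \<theta> s) * y0 + \<theta> s * y1" for s
  have Q_eq: "Q s = (y1 - y0) * \<theta> s + y0" for s by (simp add: Q_def algebra_simps)
  have \<theta>_early: "\<theta> s = 0" if "s \<le> 1" for s
    using that T by (simp add: \<theta>_def divide_nonpos_pos)
  have \<theta>_late: "\<theta> s = 1" if "T \<le> s" for s
    using that T by (simp add: \<theta>_def min_def le_divide_eq)
  have \<theta>_ramp: "\<theta> s = (s - 1) / (T - 1)" if "1 \<le> s" "s \<le> T" for s
    using that T by (simp add: \<theta>_def min_def max_def le_divide_eq divide_le_eq)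
  have \<theta>: "0 \<le> \<theta> s" "\<theta> s \<le> 1" for s by (auto simp: \<theta>_def)
  have Q0: "0 \<le> Q s" for s using \<theta>[of s] y by (simp add: Q_def)
  have "Q s \<le> 1 * y0 + 1 * y1" for s
    unfolding Q_def using \<theta>[of s] y by (intro add_mono mult_right_mono) auto
  then have Q1: "\<bar>Q s\<bar> \<le> y0 + y1" for s using Q0[of s] by simp
  have contQ: "continuous_on UNIV Q"
    unfolding Q_def[abs_def] \<theta>_def using T by (intro continuous_intros) auto
  have Q: "profile Q" by (rule continuous_profile[OF contQ Q1])
  have u0: "u0 t = Q t" if "t \<in> {0..T}" for t
    using that by (simp add: u0_def Q_eq \<theta>_early \<theta>_ramp)
  have u1: "u1 t = Q (t + 1)" if "t \<in> {0..T}" for t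
    using that by (simp add: u1_def Q_eq \<theta>_late \<theta>_ramp)
  have early: "Q s = y0" if "s \<le> 1" for s
    using that by (simp add: Q_eq \<theta>_early)
  have late: "Q s = y1" if "T \<le> s" for s
    using that by (simp add: Q_eq \<theta>_late)
  have L2Q: "(\<lambda>t. Q (c + t)) \<in> L2 0 T" for c by (rule profile_L2[OF Q])
  have L2_cong: "u \<in> L2 0 T" if "v \<in> L2 0 T" "\<And>t. t \<in> {0..T} \<Longrightarrow> u t = v t" for u v :: "real \<Rightarrow> real"
  proof -
    have "u \<in> borel_measurable (lebesgue_on {0..T}) \<longleftrightarrow> v \<in> borel_measurable (lebesgue_on {0..T})"
      by (rule measurable_cong) (use that(2) in auto)
    moreover have "integrable (lebesgue_on {0..T}) (\<lambda>x. (u x)\<^sup>2) \<longleftrightarrow> integrable (lebesgue_on {0..T}) (\<lambda>x. (v x)\<^sup>2)"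
      by (rule Bochner_Integration.integrable_cong) (use that(2) in auto)
    ultimately show ?thesis using that(1) by (simp add: L2_def)
  qed
  have u0L: "u0 \<in> L2 0 T" by (rule L2_cong[OF L2Q[of 0]]) (simp add: u0)
  have u1L: "u1 \<in> L2 0 T" by (rule L2_cong[OF L2Q[of 1]]) (simp add: u1 add.commute)
  show nn: "\<forall>t\<in>{0..T}. 0 \<le> u0 t \<and> 0 \<le> u1 t" by (simp add: u0 u1 Q0)
  show "u0 \<in> L2_nonneg 0 T" "u1 \<in> L2_nonneg 0 T"
    using u0L u1L nn by (auto simp: L2_nonneg_def intro!: AE_I2)
  have "drives T (\<lambda>_. y0) (\<lambda>_. y1) u0 u1 (dalembert Q (\<lambda>_. 0)) (dalembert_velocity Q (\<lambda>_. 0))"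
    by (rule dalembert_drives[OF _ Q profile_const u0L u1L, where c = y0 and c' = y1])
      (use T in \<open>auto simp: u0 u1 early late\<close>)
  moreover have "continuous_on ({0..T} \<times> {0..1}) (\<lambda>p. dalembert Q (\<lambda>_. 0) (fst p) (snd p))"
    unfolding dalembert_def by (intro continuous_intros continuous_on_compose2[OF contQ]) auto
  moreover have "\<forall>t\<in>{0..T}. \<forall>x\<in>{0..1}. 0 \<le> dalembert Q (\<lambda>_. 0) t x"
    by (simp add: dalembert_def Q0)
  ultimately show "\<exists>y z. drives T (\<lambda>_. y0) (\<lambda>_. y1) u0 u1 y z \<and>
       continuous_on ({0..T} \<times> {0..1}) (\<lambda>p. y (fst p) (snd p)) \<and>
       (\<forall>t\<in>{0..T}. \<forall>x\<in>{0..1}. 0 \<le> y t x)" by blast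
qed

lemma minimal_times:
  assumes y: "0 \<le> y0" "0 \<le> y1" and ne: "y0 \<noteq> y1"
  shows "T_min (\<lambda>_. y0) (\<lambda>_. y1) = 1" "T_min_c (\<lambda>_. y0) (\<lambda>_. y1) = 1" "T_min_s (\<lambda>_. y0) (\<lambda>_. y1) = 1"
proof -
  \<comment> \<open>Constraints can only increase the minimal time, and time 1 is attained under all of them.\<close>
  have "1 \<le> T_min (\<lambda>_. y0) (\<lambda>_. y1)"
    unfolding T_min_def
  proof (rule Inf_greatest)
    fix E assume "E \<in> ereal ` {T. 0 < T \<and> (\<exists>u0\<in>L2 0 T. \<exists>u1\<in>L2 0 T. \<exists>y z. drives T (\<lambda>_. y0) (\<lambda>_. y1) u0 u1 y z)}"
    then obtain T u0 u1 y z where "E = ereal T" "drives T (\<lambda>_. y0) (\<lambda>_. y1) u0 u1 y z" by auto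
    then show "1 \<le> E" using reaching_different_rest_state_takes_time_1 ne by (cases "T < 1") auto
  qed
  moreover have "T_min (\<lambda>_. y0) (\<lambda>_. y1) \<le> T_min_c (\<lambda>_. y0) (\<lambda>_. y1)"
    unfolding T_min_def T_min_c_def
    by (intro Inf_superset_mono image_mono) (use L2_nonneg_subset in blast)
  moreover have "T_min_c (\<lambda>_. y0) (\<lambda>_. y1) \<le> T_min_s (\<lambda>_. y0) (\<lambda>_. y1)"
    unfolding T_min_c_def T_min_s_def by (intro Inf_superset_mono image_mono) blast
  moreover have "T_min_s (\<lambda>_. y0) (\<lambda>_. y1) \<le> 1"
    unfolding T_min_s_def
  proof (rule Inf_lower)
    have "\<exists>y z. drives 1 (\<lambda>_. y0) (\<lambda>_. y1) (\<lambda>_. y0) (\<lambda>_. y1) y z \<and> nonneg_state 1 y"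
      using step_drives[OF y, of 0] by simp
    then show "1 \<in> ereal ` {T. 0 < T \<and> (\<exists>u0\<in>L2_nonneg 0 T. \<exists>u1\<in>L2_nonneg 0 T. \<exists>y z.
        drives T (\<lambda>_. y0) (\<lambda>_. y1) u0 u1 y z \<and> nonneg_state T y)}"
      unfolding one_ereal_def
      by (intro imageI CollectI conjI bexI[of _ "\<lambda>_. y0"] bexI[of _ "\<lambda>_. y1"] const_in_L2_nonneg y) auto
  qed
  ultimately show "T_min (\<lambda>_. y0) (\<lambda>_. y1) = 1" "T_min_c (\<lambda>_. y0) (\<lambda>_. y1) = 1" "T_min_s (\<lambda>_. y0) (\<lambda>_. y1) = 1"
    by order+
qed

theorem proposition1:
  fixes y0 y1 :: real
  assumes "0 \<le> y0" and "0 \<le> y1"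
  shows "(\<forall>T>1.
            let u0 = (\<lambda>t. if t \<le> 1 then y0 else (y1 - y0) * ((t - 1) / (T - 1)) + y0);
                u1 = (\<lambda>t. if t < T - 1 then (y1 - y0) * (t / (T - 1)) + y0 else y1)
            in u0 \<in> L2_nonneg 0 T \<and> u1 \<in> L2_nonneg 0 T \<and>
               (\<forall>t\<in>{0..T}. 0 \<le> u0 t \<and> 0 \<le> u1 t) \<and>
               (\<exists>y z. drives T (\<lambda>_. y0) (\<lambda>_. y1) u0 u1 y z \<and>
                  continuous_on ({0..T} \<times> {0..1}) (\<lambda>p. y (fst p) (snd p)) \<and>
                  (\<forall>t\<in>{0..T}. \<forall>x\<in>{0..1}. 0 \<le> y t x)))
       \<and> (y0 \<noteq> y1 \<longrightarrow>
            T_min_s (\<lambda>_. y0) (\<lambda>_. y1) = T_min_c (\<lambda>_. y0) (\<lambda>_. y1) \<and>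
            T_min_c (\<lambda>_. y0) (\<lambda>_. y1) = T_min (\<lambda>_. y0) (\<lambda>_. y1) \<and>
            T_min (\<lambda>_. y0) (\<lambda>_. y1) = 1)
       \<and> ((\<lambda>_. y0) \<in> L2_nonneg 0 1 \<and> (\<lambda>_. y1) \<in> L2_nonneg 0 1 \<and>
          (\<exists>y z. drives 1 (\<lambda>_. y0) (\<lambda>_. y1) (\<lambda>_. y0) (\<lambda>_. y1) y z \<and> nonneg_state 1 y))
       \<and> (y0 \<noteq> y1 \<longrightarrow>
            (\<exists>u0\<in>L2_nonneg 0 1. \<exists>u1\<in>L2_nonneg 0 1. \<exists>v0\<in>L2_nonneg 0 1. \<exists>v1\<in>L2_nonneg 0 1.
               (\<exists>y z. drives 1 (\<lambda>_. y0) (\<lambda>_. y1) u0 u1 y z \<and> nonneg_state 1 y) \<and>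
               (\<exists>y z. drives 1 (\<lambda>_. y0) (\<lambda>_. y1) v0 v1 y z \<and> nonneg_state 1 y) \<and>
               \<not> ((AE t in lebesgue_on {0..1}. u0 t = v0 t) \<and>
                  (AE t in lebesgue_on {0..1}. u1 t = v1 t))))
       \<and> (\<forall>l\<in>{0..1}. \<exists>y z.
            drives 1 (\<lambda>_. y0) (\<lambda>_. y1)
              (\<lambda>_. (1 - l) * y0 + l * y1) (\<lambda>_. (1 - l) * y1 + l * y0) y z)"
proof -
  note y = assms
  have ramp: "let u0 = (\<lambda>t. if t \<le> 1 then y0 else (y1 - y0) * ((t - 1) / (T - 1)) + y0);
                u1 = (\<lambda>t. if t < T - 1 then (y1 - y0) * (t / (T - 1)) + y0 else y1)
            in u0 \<in> L2_nonneg 0 T \<and> u1 \<in> L2_nonneg 0 T \<and>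
               (\<forall>t\<in>{0..T}. 0 \<le> u0 t \<and> 0 \<le> u1 t) \<and>
               (\<exists>y z. drives T (\<lambda>_. y0) (\<lambda>_. y1) u0 u1 y z \<and>
                  continuous_on ({0..T} \<times> {0..1}) (\<lambda>p. y (fst p) (snd p)) \<and>
                  (\<forall>t\<in>{0..T}. \<forall>x\<in>{0..1}. 0 \<le> y t x))" if "1 < T" for T
    unfolding Let_def using ramp_drives[OF y that] by simp
  have fwd: "\<exists>y z. drives 1 (\<lambda>_. y0) (\<lambda>_. y1) (\<lambda>_. y0) (\<lambda>_. y1) y z \<and> nonneg_state 1 y"
    using step_drives[OF y, of 0] by simp
  have bwd: "\<exists>y z. drives 1 (\<lambda>_. y0) (\<lambda>_. y1) (\<lambda>_. y1) (\<lambda>_. y0) y z \<and> nonneg_state 1 y"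
    using step_drives[OF y, of 1] by simp
  have nn: "(\<lambda>_. y0) \<in> L2_nonneg 0 1" "(\<lambda>_. y1) \<in> L2_nonneg 0 1"
    using y by (simp_all add: const_in_L2_nonneg)
  have many: "\<exists>u0\<in>L2_nonneg 0 1. \<exists>u1\<in>L2_nonneg 0 1. \<exists>v0\<in>L2_nonneg 0 1. \<exists>v1\<in>L2_nonneg 0 1.
      (\<exists>y z. drives 1 (\<lambda>_. y0) (\<lambda>_. y1) u0 u1 y z \<and> nonneg_state 1 y) \<and>
      (\<exists>y z. drives 1 (\<lambda>_. y0) (\<lambda>_. y1) v0 v1 y z \<and> nonneg_state 1 y) \<and>
      \<not> ((AE t in lebesgue_on {0..1}. u0 t = v0 t) \<and> (AE t in lebesgue_on {0..1}. u1 t = v1 t))"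
    if "y0 \<noteq> y1"
  proof (rule bexI[OF _ nn(1)], rule bexI[OF _ nn(2)], rule bexI[OF _ nn(2)], rule bexI[OF _ nn(1)], intro conjI)
    \<comment> \<open>The unit interval is not a null set.\<close>
    have "\<not> (AE t in lebesgue_on {0..1::real}. y0 = y1)"
      using that by (simp add: eventually_const_iff ae_filter_eq_bot_iff emeasure_restrict_space)
    then show "\<not> ((AE t in lebesgue_on {0..1::real}. y0 = y1) \<and> (AE t in lebesgue_on {0..1::real}. y1 = y0))"
      by blast
  qed (rule fwd, rule bwd)
  have interp: "\<exists>y z. drives 1 (\<lambda>_. y0) (\<lambda>_. y1)
      (\<lambda>_. (1 - l) * y0 + l * y1) (\<lambda>_. (1 - l) * y1 + l * y0) y z" if "l \<in> {0..1}" for l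
    using step_drives[OF y that] by (elim exE conjE) (intro exI)
  show ?thesis
    using ramp nn fwd many interp minimal_times[OF y]
    by (intro conjI allI impI ballI) (simp_all only: simp_thms)
qed

end
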